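(* If $X_0,X_1\in\mathrm{Ind}\text{-}(\mathrm{Vect}^{\mathrm{op}})$ are $\mathcal{Q}_4$-free, then $X_0\mathbin{\hat\otimes}X_1$ is $\mathcal{Q}_4$-free.
   Context: Fix a field $\mathbf{k}$ and a (non-trivial) Grothendieck universe; sets in it are small. $\mathrm{Vect}$ is the category of small $\mathbf{k}$-vector spaces, $[\mathrm{Vect},\mathrm{Vect}]$ the category of $\mathbf{k}$-additive functors (acting $\mathbf{k}$-linearly on hom-spaces) and natural transformations, $\mathbb{Y}V:=\mathrm{Vect}(V,-)$. $\mathrm{Ind}\text{-}(\mathrm{Vect}^{\mathrm{op}})$ is the full subcategory of $[\mathrm{Vect},\mathrm{Vect}]$ on the small functors, i.e. those isomorphic to a colimit, over a small directed poset, of representables $\mathbb{Y}V$. The tensor product $\hat\otimes$ on $\mathrm{Ind}\text{-}(\mathrm{Vect}^{\mathrm{op}})$ is the functor induced by $\otimes_{\mathbf{k}}$ on $\mathrm{Vect}^{\mathrm{op}}$: $(X\hat\otimes Y)(V)\cong\int^{H_0}\int^{H_1}X(H_0)\otimes Y(H_1)\otimes\mathrm{Vect}(H_0\otimes H_1,V)$; equivalently, if $X\cong\varinjlim_{d}\mathbb{Y}(Fd)$ and $Y\cong\varinjlim_b\mathbb{Y}(Gb)$ are small directed colimits of representables, then $X\hat\otimes Y\cong\varinjlim_{d,b}\mathbb{Y}(Fd\otimes Gb)$. A filter of subspaces of $V\in \mathrm{Vect}$ is a nonempty set of linear subspaces closed under finite intersections and under passing to larger subspaces. For $H\le V$, $\mathbb{Y}(V/H)\subseteq\mathbb{Y}V$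 is the subfunctor of linear maps vanishing on $H$. $X$ is $\mathcal{Q}_4$-free if for every $V\in\mathrm{Vect}$ and every filter $\mathcal{F}$ of subspaces of $V$ with $\bigcap\mathcal{F}=0$, the only natural transformation $\mathbb{Y}V/\bigcup_{H\in\mathcal{F}}\mathbb{Y}(V/H)\to X$ is $0$. *)

theory Defs
  imports "HOL-Algebra.Module" "HOL-Algebra.AbelCoset" "HOL-Library.FuncSet"
begin

text \<open>
  A Grothendieck universe is presented by its elements (the type \<open>'u\<close>) and the map \<open>elts\<close> sending
  each element to the set of its members; members of a universe element are again universe elements,
  so transitivity is built into the type of \<open>elts\<close>. The first two conditions are extensionality and
  foundation, the next three are closure under pairs, under power sets (all HOL subsets of a
  universe element, and the set of them, are in the universe) and under unions of families indexed
  by an element of the universe. The last one is non-triviality: some member of the universe is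
  infinite.
\<close>

definition grothendieck_universe :: "('u \<Rightarrow> 'u set) \<Rightarrow> bool" where
  "grothendieck_universe elts \<longleftrightarrow>
     inj elts \<and>
     wf {(x, y). x \<in> elts y} \<and>
     (\<forall>x y. \<exists>z. elts z = {x, y}) \<and>
     (\<forall>x. \<exists>z. elts ` elts z = Pow (elts x)) \<and>
     (\<forall>a f. \<exists>z. elts z = (\<Union>i\<in>elts a. elts (f i))) \<and>
     (\<exists>z. infinite (elts z))"

definition small :: "('u \<Rightarrow> 'u set) \<Rightarrow> 'u set \<Rightarrow> bool" where
  "small elts A \<longleftrightarrow> (\<exists>z. elts z = A)"


section \<open>Vector spaces\<close>

text \<open>
  Vector spaces are the modules of HOL-Algebra over a field \<open>K\<close>. The fields \<open>mult\<close> and \<open>one\<close> of a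
  module record play no role and are unconstrained.
\<close>

definition Vect :: "('k, 'm) ring_scheme \<Rightarrow> ('u \<Rightarrow> 'u set) \<Rightarrow> ('k, 'u) module set" where
  "Vect K elts = {V. module K V \<and> small elts (carrier V)}"

definition hom_sp ::
  "('k, 'm) ring_scheme \<Rightarrow> ('k, 'a) module \<Rightarrow> ('k, 'b) module \<Rightarrow> ('a \<Rightarrow> 'b) set" where
  "hom_sp K V W =
     {f \<in> carrier V \<rightarrow>\<^sub>E carrier W.
        (\<forall>x\<in>carrier V. \<forall>y\<in>carrier V. f (x \<oplus>\<^bsub>V\<^esub> y) = f x \<oplus>\<^bsub>W\<^esub> f y) \<and>
        (\<forall>c\<in>carrier K. \<forall>x\<in>carrier V. f (c \<odot>\<^bsub>V\<^esub> x) = c \<odot>\<^bsub>W\<^esub> f x)}"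

definition Hom ::
  "('k, 'm) ring_scheme \<Rightarrow> ('k, 'a) module \<Rightarrow> ('k, 'b) module \<Rightarrow> ('k, 'a \<Rightarrow> 'b) module" where
  "Hom K V W =
     \<lparr>carrier = hom_sp K V W, mult = undefined, one = undefined,
      zero = (\<lambda>x\<in>carrier V. \<zero>\<^bsub>W\<^esub>),
      add = (\<lambda>f g. \<lambda>x\<in>carrier V. f x \<oplus>\<^bsub>W\<^esub> g x),
      smult = (\<lambda>c f. \<lambda>x\<in>carrier V. c \<odot>\<^bsub>W\<^esub> f x)\<rparr>"

text \<open>
  Scalar multiplication adds \<open>N\<close> back on, so that \<open>0\<close> times a coset is \<open>N\<close> and not \<open>{0}\<close>.
\<close>

definition quot_module :: "('k, 'a) module \<Rightarrow> 'a set \<Rightarrow> ('k, 'a set) module" where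
  "quot_module M N =
     \<lparr>carrier = a_rcosets\<^bsub>M\<^esub> N, mult = undefined, one = undefined,
      zero = N,
      add = (\<lambda>A B. A <+>\<^bsub>M\<^esub> B),
      smult = (\<lambda>c A. N <+>\<^bsub>M\<^esub> ((\<lambda>a. c \<odot>\<^bsub>M\<^esub> a) ` A))\<rparr>"

definition bilinear_on ::
  "('k, 'm) ring_scheme \<Rightarrow> ('k, 'a) module \<Rightarrow> ('k, 'b) module \<Rightarrow> ('k, 'c) module \<Rightarrow>
   ('a \<Rightarrow> 'b \<Rightarrow> 'c) \<Rightarrow> bool" where
  "bilinear_on K V W Z \<gamma> \<longleftrightarrow>
     (\<forall>x\<in>carrier V. (\<lambda>y\<in>carrier W. \<gamma> x y) \<in> hom_sp K W Z) \<and>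
     (\<forall>y\<in>carrier W. (\<lambda>x\<in>carrier V. \<gamma> x y) \<in> hom_sp K V Z)"

definition is_tensor ::
  "('k, 'm) ring_scheme \<Rightarrow> ('u \<Rightarrow> 'u set) \<Rightarrow> ('k, 'u) module \<Rightarrow> ('k, 'u) module \<Rightarrow>
   ('k, 'u) module \<Rightarrow> ('u \<Rightarrow> 'u \<Rightarrow> 'u) \<Rightarrow> bool" where
  "is_tensor K elts V W P \<beta> \<longleftrightarrow>
     P \<in> Vect K elts \<and> bilinear_on K V W P \<beta> \<and>
     (\<forall>Z\<in>Vect K elts. \<forall>\<gamma>. bilinear_on K V W Z \<gamma> \<longrightarrow>
        (\<exists>!f. f \<in> hom_sp K P Z \<and> (\<forall>x\<in>carrier V. \<forall>y\<in>carrier W. f (\<beta> x y) = \<gamma> x y)))"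


section \<open>Functors on small vector spaces\<close>

text \<open>
  The functors considered send small vector spaces with elements in \<open>'u\<close> to vector spaces with
  elements in some type \<open>'a\<close>. Objects of \<open>[Vect, Vect]\<close> have \<open>'a = 'u\<close> and small values. The functor
  \<open>Vect(V, -)\<close> and its quotients have \<open>'a = 'u \<Rightarrow> 'u\<close> and \<open>'a = ('u \<Rightarrow> 'u) set\<close>; their values are
  isomorphic to small spaces since the universe is closed under function sets and power sets, and
  leaving them unencoded does not affect the natural transformations from them to an object
  of \<open>[Vect, Vect]\<close>.
\<close>

record ('k, 'u, 'a) vfunctor =
  Ob :: "('k, 'u) module \<Rightarrow> ('k, 'a) module"
  Ar :: "('k, 'u) module \<Rightarrow> ('k, 'u) module \<Rightarrow> ('u \<Rightarrow> 'u) \<Rightarrow> 'a \<Rightarrow> 'a"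

text \<open>
  The second condition says that the action on each hom-space is a linear map
  \<open>Hom V W \<rightarrow> Hom (X V) (X W)\<close>; \<open>restrict\<close> is there because elements of \<open>hom_sp\<close> are extensional
  functions while \<open>Ar X V W\<close> is arbitrary outside of \<open>hom_sp K V W\<close>.
\<close>

definition Functors ::
  "('k, 'm) ring_scheme \<Rightarrow> ('u \<Rightarrow> 'u set) \<Rightarrow> ('k, 'u, 'u) vfunctor set" where
  "Functors K elts =
     {X. (\<forall>V\<in>Vect K elts. Ob X V \<in> Vect K elts) \<and>
         (\<forall>V\<in>Vect K elts. \<forall>W\<in>Vect K elts.
            restrict (Ar X V W) (hom_sp K V W) \<in> hom_sp K (Hom K V W) (Hom K (Ob X V) (Ob X W))) \<and>
         (\<forall>V\<in>Vect K elts.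
            Ar X V V (\<lambda>x\<in>carrier V. x) = (\<lambda>x\<in>carrier (Ob X V). x)) \<and>
         (\<forall>U\<in>Vect K elts. \<forall>V\<in>Vect K elts. \<forall>W\<in>Vect K elts.
            \<forall>f\<in>hom_sp K U V. \<forall>g\<in>hom_sp K V W.
              Ar X U W (compose (carrier U) g f) =
              compose (carrier (Ob X U)) (Ar X V W g) (Ar X U V f))}"

definition Nat ::
  "('k, 'm) ring_scheme \<Rightarrow> ('u \<Rightarrow> 'u set) \<Rightarrow> ('k, 'u, 'a) vfunctor \<Rightarrow> ('k, 'u, 'b) vfunctor \<Rightarrow>
   (('k, 'u) module \<Rightarrow> 'a \<Rightarrow> 'b) set" where
  "Nat K elts X Y =
     {\<eta> \<in> (\<Pi>\<^sub>E V\<in>Vect K elts. hom_sp K (Ob X V) (Ob Y V)).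
        \<forall>V\<in>Vect K elts. \<forall>W\<in>Vect K elts. \<forall>f\<in>hom_sp K V W. \<forall>x\<in>carrier (Ob X V).
          \<eta> W (Ar X V W f x) = Ar Y V W f (\<eta> V x)}"

definition Yo ::
  "('k, 'm) ring_scheme \<Rightarrow> ('k, 'u) module \<Rightarrow> ('k, 'u, 'u \<Rightarrow> 'u) vfunctor" where
  "Yo K V =
     \<lparr>Ob = Hom K V,
      Ar = (\<lambda>W W' f. \<lambda>g\<in>hom_sp K V W. compose (carrier V) f g)\<rparr>"

text \<open>
  The quotient of \<open>X\<close> by a subfunctor with values \<open>N W \<subseteq> X(W)\<close>; an arrow \<open>f\<close> sends the
  coset \<open>A\<close> to the coset of \<open>N W'\<close> containing \<open>X(f)(A)\<close>.
\<close>

definition quot_functor ::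
  "('k, 'u, 'a) vfunctor \<Rightarrow> (('k, 'u) module \<Rightarrow> 'a set) \<Rightarrow> ('k, 'u, 'a set) vfunctor" where
  "quot_functor X N =
     \<lparr>Ob = (\<lambda>W. quot_module (Ob X W) (N W)),
      Ar = (\<lambda>W W' f. \<lambda>A\<in>carrier (quot_module (Ob X W) (N W)).
              N W' <+>\<^bsub>Ob X W'\<^esub> (Ar X W W' f ` A))\<rparr>"


section \<open>Ind-objects of the opposite of \<open>Vect\<close>\<close>

definition directed_poset :: "'i set \<Rightarrow> 'i rel \<Rightarrow> bool" where
  "directed_poset I r \<longleftrightarrow>
     partial_order_on I r \<and> I \<noteq> {} \<and> (\<forall>i\<in>I. \<forall>j\<in>I. \<exists>k\<in>I. (i, k) \<in> r \<and> (j, k) \<in> r)"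

text \<open>
  A functor from the poset \<open>(I, r)\<close> to the opposite of \<open>Vect\<close>: for \<open>(i, j) \<in> r\<close> there is
  \<open>\<phi> i j : F j \<rightarrow> F i\<close>, which induces the transition \<open>Yo (F i) \<rightarrow> Yo (F j)\<close> by precomposition.
\<close>

definition op_diagram ::
  "('k, 'm) ring_scheme \<Rightarrow> ('u \<Rightarrow> 'u set) \<Rightarrow> 'i set \<Rightarrow> 'i rel \<Rightarrow>
   ('i \<Rightarrow> ('k, 'u) module) \<Rightarrow> ('i \<Rightarrow> 'i \<Rightarrow> 'u \<Rightarrow> 'u) \<Rightarrow> bool" where
  "op_diagram K elts I r F \<phi> \<longleftrightarrow>
     (\<forall>i\<in>I. F i \<in> Vect K elts) \<and>
     (\<forall>(i, j)\<in>r. \<phi> i j \<in> hom_sp K (F j) (F i)) \<and>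
     (\<forall>i\<in>I. \<phi> i i = (\<lambda>x\<in>carrier (F i). x)) \<and>
     (\<forall>i j k. (i, j) \<in> r \<longrightarrow> (j, k) \<in> r \<longrightarrow>
        \<phi> i k = compose (carrier (F k)) (\<phi> i j) (\<phi> j k))"

definition is_cocone ::
  "('k, 'm) ring_scheme \<Rightarrow> ('u \<Rightarrow> 'u set) \<Rightarrow> 'i set \<Rightarrow> 'i rel \<Rightarrow>
   ('i \<Rightarrow> ('k, 'u) module) \<Rightarrow> ('i \<Rightarrow> 'i \<Rightarrow> 'u \<Rightarrow> 'u) \<Rightarrow> ('k, 'u, 'u) vfunctor \<Rightarrow>
   ('i \<Rightarrow> ('k, 'u) module \<Rightarrow> ('u \<Rightarrow> 'u) \<Rightarrow> 'u) \<Rightarrow> bool" where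
  "is_cocone K elts I r F \<phi> X \<kappa> \<longleftrightarrow>
     X \<in> Functors K elts \<and>
     (\<forall>i\<in>I. \<kappa> i \<in> Nat K elts (Yo K (F i)) X) \<and>
     (\<forall>(i, j)\<in>r. \<forall>V\<in>Vect K elts. \<forall>g\<in>hom_sp K (F i) V.
        \<kappa> j V (compose (carrier (F j)) g (\<phi> i j)) = \<kappa> i V g)"

text \<open>
  \<open>X\<close> is a colimit in \<open>[Vect, Vect]\<close> of the diagram of representables \<open>i \<mapsto> Yo (F i)\<close>, with
  colimit cocone \<open>\<kappa>\<close>.
\<close>

definition is_colimit ::
  "('k, 'm) ring_scheme \<Rightarrow> ('u \<Rightarrow> 'u set) \<Rightarrow> 'i set \<Rightarrow> 'i rel \<Rightarrow>
   ('i \<Rightarrow> ('k, 'u) module) \<Rightarrow> ('i \<Rightarrow> 'i \<Rightarrow> 'u \<Rightarrow> 'u) \<Rightarrow> ('k, 'u, 'u) vfunctor \<Rightarrow>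
   ('i \<Rightarrow> ('k, 'u) module \<Rightarrow> ('u \<Rightarrow> 'u) \<Rightarrow> 'u) \<Rightarrow> bool" where
  "is_colimit K elts I r F \<phi> X \<kappa> \<longleftrightarrow>
     is_cocone K elts I r F \<phi> X \<kappa> \<and>
     (\<forall>Z \<mu>. is_cocone K elts I r F \<phi> Z \<mu> \<longrightarrow>
        (\<exists>!\<eta>. \<eta> \<in> Nat K elts X Z \<and>
           (\<forall>i\<in>I. \<forall>V\<in>Vect K elts. \<forall>g\<in>hom_sp K (F i) V. \<eta> V (\<kappa> i V g) = \<mu> i V g)))"

definition ind_presentation ::
  "('k, 'm) ring_scheme \<Rightarrow> ('u \<Rightarrow> 'u set) \<Rightarrow> 'u set \<Rightarrow> 'u rel \<Rightarrow>
   ('u \<Rightarrow> ('k, 'u) module) \<Rightarrow> ('u \<Rightarrow> 'u \<Rightarrow> 'u \<Rightarrow> 'u) \<Rightarrow> ('k, 'u, 'u) vfunctor \<Rightarrow> bool" where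
  "ind_presentation K elts I r F \<phi> X \<longleftrightarrow>
     small elts I \<and> directed_poset I r \<and> op_diagram K elts I r F \<phi> \<and>
     (\<exists>\<kappa>. is_colimit K elts I r F \<phi> X \<kappa>)"

definition Ind_Vect_op ::
  "('k, 'm) ring_scheme \<Rightarrow> ('u \<Rightarrow> 'u set) \<Rightarrow> ('k, 'u, 'u) vfunctor set" where
  "Ind_Vect_op K elts = {X. \<exists>I r F \<phi>. ind_presentation K elts I r F \<phi> X}"

definition prod_rel :: "'i rel \<Rightarrow> 'j rel \<Rightarrow> ('i \<times> 'j) rel" where
  "prod_rel r s = {((i, j), (i', j')). (i, i') \<in> r \<and> (j, j') \<in> s}"

text \<open>
  \<open>T\<close> is a tensor product of the ind-objects \<open>X\<close> and \<open>Y\<close> if \<open>X = colim Yo (F d)\<close> and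
  \<open>Y = colim Yo (G b)\<close> as small directed colimits and \<open>T = colim Yo (F d \<otimes> G b)\<close> over the product
  poset. Here \<open>P (d, b)\<close> with the universal bilinear map \<open>\<beta> (d, b)\<close> is \<open>F d \<otimes> G b\<close>, and
  the transitions \<open>\<tau>\<close> are the maps \<open>\<phi> d d' \<otimes> \<psi> b b'\<close>. Such a \<open>T\<close> exists and is unique up to
  isomorphism, being the value at \<open>(X, Y)\<close> of the functor induced by the tensor product on \<open>Vect\<close>.
\<close>

definition is_ind_tensor ::
  "('k, 'm) ring_scheme \<Rightarrow> ('u \<Rightarrow> 'u set) \<Rightarrow> ('k, 'u, 'u) vfunctor \<Rightarrow> ('k, 'u, 'u) vfunctor \<Rightarrow>
   ('k, 'u, 'u) vfunctor \<Rightarrow> bool" where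
  "is_ind_tensor K elts X Y T \<longleftrightarrow>
     (\<exists>D r F \<phi> B s G \<psi> P \<beta> \<tau> \<nu>.
        ind_presentation K elts D r F \<phi> X \<and>
        ind_presentation K elts B s G \<psi> Y \<and>
        (\<forall>d\<in>D. \<forall>b\<in>B. is_tensor K elts (F d) (G b) (P (d, b)) (\<beta> (d, b))) \<and>
        (\<forall>(d, d')\<in>r. \<forall>(b, b')\<in>s.
           \<tau> (d, b) (d', b') \<in> hom_sp K (P (d', b')) (P (d, b)) \<and>
           (\<forall>x\<in>carrier (F d'). \<forall>y\<in>carrier (G b').
              \<tau> (d, b) (d', b') (\<beta> (d', b') x y) = \<beta> (d, b) (\<phi> d d' x) (\<psi> b b' y))) \<and>
        is_colimit K elts (D \<times> B) (prod_rel r s) P \<tau> T \<nu>)"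


section \<open>\<open>Q\<^sub>4\<close>-free functors\<close>

definition subspace_filter ::
  "('k, 'm) ring_scheme \<Rightarrow> ('k, 'u) module \<Rightarrow> 'u set set \<Rightarrow> bool" where
  "subspace_filter K V \<F> \<longleftrightarrow>
     \<F> \<noteq> {} \<and> (\<forall>H\<in>\<F>. submodule H K V) \<and>
     (\<forall>H\<in>\<F>. \<forall>H'\<in>\<F>. H \<inter> H' \<in> \<F>) \<and>
     (\<forall>H\<in>\<F>. \<forall>H'. submodule H' K V \<longrightarrow> H \<subseteq> H' \<longrightarrow> H' \<in> \<F>)"

text \<open>The value at \<open>W\<close> of the subfunctor \<open>Yo (V/H)\<close> of \<open>Yo V\<close>.\<close>

definition Yo_vanishing ::
  "('k, 'm) ring_scheme \<Rightarrow> ('k, 'u) module \<Rightarrow> 'u set \<Rightarrow> ('k, 'u) module \<Rightarrow> ('u \<Rightarrow> 'u) set" where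
  "Yo_vanishing K V H W = {f \<in> hom_sp K V W. \<forall>x\<in>H. f x = \<zero>\<^bsub>W\<^esub>}"

definition Q4_free ::
  "('k, 'm) ring_scheme \<Rightarrow> ('u \<Rightarrow> 'u set) \<Rightarrow> ('k, 'u, 'u) vfunctor \<Rightarrow> bool" where
  "Q4_free K elts X \<longleftrightarrow>
     (\<forall>V\<in>Vect K elts. \<forall>\<F>. subspace_filter K V \<F> \<longrightarrow> \<Inter>\<F> = {\<zero>\<^bsub>V\<^esub>} \<longrightarrow>
        (let Q = quot_functor (Yo K V) (\<lambda>W. \<Union>H\<in>\<F>. Yo_vanishing K V H W) in
         \<forall>\<eta>\<in>Nat K elts Q X. \<forall>W\<in>Vect K elts. \<forall>A\<in>carrier (Ob Q W). \<eta> W A = \<zero>\<^bsub>Ob X W\<^esub>))"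

end

theory Submission
  imports Defs
begin

text \<open>
  By Yoneda, \<open>X\<close> is \<open>Q\<^sub>4\<close>-free iff an element of \<open>X(V)\<close> vanishes as soon as, for some filter with
  intersection \<open>0\<close>, it is killed by every linear map that vanishes on a member of the filter. For
  \<open>X = colim Yo (F d)\<close> this amounts to a Mittag-Leffler condition: for each \<open>d\<close> the images of
  \<open>F e \<rightarrow> F d\<close> are constant from some \<open>e\<close> on. To see that freeness implies it, apply freeness to the
  filter generated by these images in the quotient of \<open>F d\<close> by their intersection. The converse is
  direct, since a stable image contained in every member of the filter is zero. Finally,
  the image of \<open>\<phi> \<otimes> \<psi>\<close> is generated by the tensors \<open>\<phi> x \<otimes> \<psi> y\<close>, hence depends only on the images
  of \<open>\<phi>\<close> and \<open>\<psi>\<close>, so the Mittag-Leffler condition passes to \<open>colim Yo (F d \<otimes> G b)\<close>.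
\<close>

section \<open>Linear algebra\<close>

text \<open>The difficulty is that a colimit is known only through its universal property, tested
  against functors with small values of type \<open>'u\<close>; nothing says that it is computed
  pointwise. Two facts have to be extracted from that property: every element comes from a leg, and
  a leg sends a linear map to zero only if the map dies at a later index. Each is obtained by
  testing against a suitable functor. The second fact is what turns the vanishing of a class into an
  inclusion of images. The quotient by the intersection \<open>J\<close> of the images is needed
  because freeness speaks only of filters with intersection zero; the class to which freeness is
  applied is that of the projection \<open>F d \<rightarrow> F d / J\<close>. Since test spaces must
  be small with elements in \<open>'u\<close>, quotients and function spaces are re-encoded through
  names of sets in the universe.\<close>

lemma (in abelian_group) minus_eq_zero_iff:
  assumes "x \<in> carrier G" "y \<in> carrier G"
  shows "x \<ominus> y = \<zero> \<longleftrightarrow> x = y"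
proof
  assume "x \<ominus> y = \<zero>"
  then have "\<ominus> (\<ominus> y) = x" using assms by (intro minus_equality) (simp_all add: a_minus_def)
  then show "x = y" using assms by simp
qed (use assms in \<open>simp add: a_minus_def r_neg\<close>)

text \<open>Negatives are multiples by the scalar -1, so closure under them need not be checked
  separately.\<close>

lemma (in module) submoduleI':
  assumes "H \<subseteq> carrier M" and "\<zero>\<^bsub>M\<^esub> \<in> H"
    and "\<And>a b. \<lbrakk>a \<in> H; b \<in> H\<rbrakk> \<Longrightarrow> a \<oplus>\<^bsub>M\<^esub> b \<in> H"
    and "\<And>a x. \<lbrakk>a \<in> carrier R; x \<in> H\<rbrakk> \<Longrightarrow> a \<odot>\<^bsub>M\<^esub> x \<in> H"
  shows "submodule H R M"
proof (rule submoduleI)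
  fix a assume a: "a \<in> H"
  then have "\<ominus>\<^bsub>M\<^esub> a = (\<ominus> \<one>) \<odot>\<^bsub>M\<^esub> a"
    using assms(1) by (subst smult_l_minus) auto
  then show "\<ominus>\<^bsub>M\<^esub> a \<in> H" using assms(4) a by auto
qed (use assms in auto)

lemma (in module) submodule_zero: "submodule H R M \<Longrightarrow> \<zero>\<^bsub>M\<^esub> \<in> H"
  using subgroup.one_closed[OF submodule.axioms(1)] by fastforce

lemma (in module) submodule_abelian_subgroup: "submodule H R M \<Longrightarrow> abelian_subgroup H M"
  by (simp add: abelian_subgroupI3 additive_subgroupI M.abelian_group_axioms submodule.axioms(1))

text \<open>\<open>N\<close> is a bare record with operations, not assumed to be a module. The
  module laws are equations and every element of \<open>N\<close> is some \<open>p x\<close>, so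
  they are inherited from \<open>M\<close>; the inverse of \<open>p x\<close> is the image of the
  inverse of \<open>x\<close>. Quotients, whose operations are given on classes, become modules this
  way.\<close>

lemma module_epi:
  fixes N (structure)
  assumes "module K M" and carrier: "carrier N = p ` carrier M"
    and zero: "\<zero> = p \<zero>\<^bsub>M\<^esub>"
    and add: "\<And>x y. \<lbrakk>x \<in> carrier M; y \<in> carrier M\<rbrakk> \<Longrightarrow> p x \<oplus> p y = p (x \<oplus>\<^bsub>M\<^esub> y)"
    and smult: "\<And>c x. \<lbrakk>c \<in> carrier K; x \<in> carrier M\<rbrakk> \<Longrightarrow> c \<odot> p x = p (c \<odot>\<^bsub>M\<^esub> x)"
  shows "module K N"
proof -
  interpret M: module K M by fact
  have "abelian_group N"
  proof (rule abelian_groupI)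
    fix x assume "x \<in> carrier N"
    then obtain a where a: "a \<in> carrier M" "x = p a" by (auto simp: carrier)
    have "p (\<ominus>\<^bsub>M\<^esub> a) \<oplus> x = \<zero>" using a by (simp add: add zero M.l_neg)
    then show "\<exists>y\<in>carrier N. y \<oplus> x = \<zero>" using a by (auto simp: carrier)
  qed (auto simp: carrier zero add M.a_ac)
  then show ?thesis
    by (rule moduleI[OF M.R.is_cring])
      (auto simp: carrier add smult M.smult_l_distr M.smult_r_distr M.smult_assoc1)
qed

section \<open>Linear maps as extensional functions\<close>

lemma hom_spI:
  assumes "f \<in> extensional (carrier V)" "\<And>x. x \<in> carrier V \<Longrightarrow> f x \<in> carrier W"
    "\<And>x y. \<lbrakk>x \<in> carrier V; y \<in> carrier V\<rbrakk> \<Longrightarrow> f (x \<oplus>\<^bsub>V\<^esub> y) = f x \<oplus>\<^bsub>W\<^esub> f y"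
    "\<And>c x. \<lbrakk>c \<in> carrier K; x \<in> carrier V\<rbrakk> \<Longrightarrow> f (c \<odot>\<^bsub>V\<^esub> x) = c \<odot>\<^bsub>W\<^esub> f x"
  shows "f \<in> hom_sp K V W"
  using assms by (auto simp: hom_sp_def PiE_def)

lemma
  assumes "f \<in> hom_sp K V W"
  shows hom_sp_ext: "f \<in> extensional (carrier V)"
    and hom_sp_closed: "x \<in> carrier V \<Longrightarrow> f x \<in> carrier W"
    and hom_sp_add: "\<lbrakk>x \<in> carrier V; y \<in> carrier V\<rbrakk> \<Longrightarrow> f (x \<oplus>\<^bsub>V\<^esub> y) = f x \<oplus>\<^bsub>W\<^esub> f y"
    and hom_sp_smult: "\<lbrakk>c \<in> carrier K; x \<in> carrier V\<rbrakk> \<Longrightarrow> f (c \<odot>\<^bsub>V\<^esub> x) = c \<odot>\<^bsub>W\<^esub> f x"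
  using assms by (auto simp: hom_sp_def PiE_def)

lemma hom_sp_eqI:
  assumes "f \<in> hom_sp K V W" "g \<in> hom_sp K V W'" "\<And>x. x \<in> carrier V \<Longrightarrow> f x = g x"
  shows "f = g"
  using assms by (blast intro: extensionalityI hom_sp_ext)

lemma hom_sp_zero:
  assumes "module K V" "module K W" "f \<in> hom_sp K V W"
  shows "f \<zero>\<^bsub>V\<^esub> = \<zero>\<^bsub>W\<^esub>"
proof -
  interpret V: module K V by fact
  interpret W: module K W by fact
  have "f \<zero>\<^bsub>V\<^esub> \<oplus>\<^bsub>W\<^esub> f \<zero>\<^bsub>V\<^esub> = f \<zero>\<^bsub>V\<^esub>"
    using hom_sp_add[OF assms(3), of "\<zero>\<^bsub>V\<^esub>" "\<zero>\<^bsub>V\<^esub>"] by simp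
  then show ?thesis using hom_sp_closed[OF assms(3)] by simp
qed

lemma hom_sp_minus:
  assumes "module K V" "module K W" "f \<in> hom_sp K V W" "x \<in> carrier V" "y \<in> carrier V"
  shows "f (x \<ominus>\<^bsub>V\<^esub> y) = f x \<ominus>\<^bsub>W\<^esub> f y"
proof -
  interpret V: module K V by fact
  interpret W: module K W by fact
  have "f (\<ominus>\<^bsub>V\<^esub> y) \<oplus>\<^bsub>W\<^esub> f y = \<zero>\<^bsub>W\<^esub>"
    using hom_sp_add[OF assms(3), of "\<ominus>\<^bsub>V\<^esub> y" y] assms(5) hom_sp_zero[OF assms(1-3)]
    by (simp add: V.l_neg)
  then have "f (\<ominus>\<^bsub>V\<^esub> y) = \<ominus>\<^bsub>W\<^esub> f y"
    using hom_sp_closed[OF assms(3)] assms(5) by (simp add: W.minus_equality)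
  then show ?thesis
    using assms hom_sp_add[OF assms(3)] by (simp add: a_minus_def)
qed

lemma hom_sp_compose:
  assumes "module K U" "f \<in> hom_sp K U V" "g \<in> hom_sp K V W"
  shows "compose (carrier U) g f \<in> hom_sp K U W"
proof -
  interpret U: module K U by fact
  show ?thesis
    by (rule hom_spI) (auto simp: compose_def hom_sp_closed[OF assms(2)] hom_sp_closed[OF assms(3)]
      hom_sp_add[OF assms(2)] hom_sp_add[OF assms(3)] hom_sp_smult[OF assms(2)] hom_sp_smult[OF assms(3)])
qed

lemma hom_sp_id: "module K V \<Longrightarrow> (\<lambda>x\<in>carrier V. x) \<in> hom_sp K V V"
proof -
  assume "module K V"
  then interpret module K V .
  show ?thesis by (rule hom_spI) auto
qed

lemma hom_sp_image_submodule:
  assumes "module K V" "module K W" "f \<in> hom_sp K V W" "submodule H K V"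
  shows "submodule (f ` H) K W"
proof -
  interpret V: module K V by fact
  interpret W: module K W by fact
  note H = V.submoduleE[OF assms(4)] V.submodule_zero[OF assms(4)]
  show ?thesis
  proof (rule W.submoduleI')
    show "f ` H \<subseteq> carrier W" using H(1) hom_sp_closed[OF assms(3)] by auto
    show "\<zero>\<^bsub>W\<^esub> \<in> f ` H" using H(7) hom_sp_zero[OF assms(1-3)] by force
    fix a b assume "a \<in> f ` H" "b \<in> f ` H"
    then obtain x y where "x \<in> H" "y \<in> H" "a = f x" "b = f y" by auto
    then show "a \<oplus>\<^bsub>W\<^esub> b \<in> f ` H" using H hom_sp_add[OF assms(3), of x y] by (metis imageI subsetD)
  next
    fix c a assume "c \<in> carrier K" "a \<in> f ` H"
    then obtain x where "x \<in> H" "a = f x" by auto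
    then show "c \<odot>\<^bsub>W\<^esub> a \<in> f ` H"
      using H hom_sp_smult[OF assms(3), of c x] \<open>c \<in> carrier K\<close> by (metis imageI subsetD)
  qed
qed

text \<open>The power of \<open>W\<close> indexed by \<open>A\<close>. It contains
  \<open>Hom K V W\<close> for \<open>A = carrier V\<close>, and its quotients are the values of the
  functor against which colimits are tested below.\<close>

definition fun_module :: "'b set \<Rightarrow> ('k, 'a) module \<Rightarrow> ('k, 'b \<Rightarrow> 'a) module" where
  "fun_module A W =
     \<lparr>carrier = A \<rightarrow>\<^sub>E carrier W, mult = undefined, one = undefined,
      zero = (\<lambda>x\<in>A. \<zero>\<^bsub>W\<^esub>),
      add = (\<lambda>f g. \<lambda>x\<in>A. f x \<oplus>\<^bsub>W\<^esub> g x),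
      smult = (\<lambda>c f. \<lambda>x\<in>A. c \<odot>\<^bsub>W\<^esub> f x)\<rparr>"

lemma fun_module_simps:
  "carrier (fun_module A W) = A \<rightarrow>\<^sub>E carrier W"
  "\<zero>\<^bsub>fun_module A W\<^esub> = (\<lambda>x\<in>A. \<zero>\<^bsub>W\<^esub>)"
  "u \<oplus>\<^bsub>fun_module A W\<^esub> v = (\<lambda>x\<in>A. u x \<oplus>\<^bsub>W\<^esub> v x)"
  "c \<odot>\<^bsub>fun_module A W\<^esub> u = (\<lambda>x\<in>A. c \<odot>\<^bsub>W\<^esub> u x)"
  by (simp_all add: fun_module_def)

lemma module_fun_module:
  assumes "module K W" shows "module K (fun_module A W)"
proof -
  interpret W: module K W by fact
  have "abelian_group (fun_module A W)"
  proof (rule abelian_groupI)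
    fix f assume f: "f \<in> carrier (fun_module A W)"
    have "(\<lambda>x\<in>A. \<ominus>\<^bsub>W\<^esub> f x) \<oplus>\<^bsub>fun_module A W\<^esub> f = \<zero>\<^bsub>fun_module A W\<^esub>"
      using f by (auto simp: fun_module_def PiE_iff W.l_neg intro!: restrict_ext)
    moreover have "(\<lambda>x\<in>A. \<ominus>\<^bsub>W\<^esub> f x) \<in> carrier (fun_module A W)"
      using f by (auto simp: fun_module_def PiE_iff)
    ultimately show "\<exists>g\<in>carrier (fun_module A W). g \<oplus>\<^bsub>fun_module A W\<^esub> f = \<zero>\<^bsub>fun_module A W\<^esub>" by blast
  next
    fix f assume f: "f \<in> carrier (fun_module A W)"
    show "\<zero>\<^bsub>fun_module A W\<^esub> \<oplus>\<^bsub>fun_module A W\<^esub> f = f"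
      using f by (auto simp: fun_module_def PiE_iff intro!: extensionalityI[of _ A])
  qed (auto simp: fun_module_def PiE_iff W.a_ac intro!: restrict_ext)
  then show ?thesis
    by (rule moduleI[OF W.R.is_cring])
      (auto simp: fun_module_def PiE_iff W.smult_l_distr W.smult_r_distr W.smult_assoc1
        intro!: restrict_ext extensionalityI[of _ A])
qed

text \<open>Apart from the carrier the two records agree field by field, so \<open>Hom\<close> gets
  its module structure as a submodule of a power of \<open>W\<close>.\<close>

lemma Hom_eq_submodule: "Hom K V W = fun_module (carrier V) W\<lparr>carrier := hom_sp K V W\<rparr>"
  by (simp add: Hom_def fun_module_def)

lemma Hom_simps [simp]:
  "carrier (Hom K V W) = hom_sp K V W"
  "\<zero>\<^bsub>Hom K V W\<^esub> = (\<lambda>x\<in>carrier V. \<zero>\<^bsub>W\<^esub>)"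
  "f \<oplus>\<^bsub>Hom K V W\<^esub> g = (\<lambda>x\<in>carrier V. f x \<oplus>\<^bsub>W\<^esub> g x)"
  "c \<odot>\<^bsub>Hom K V W\<^esub> f = (\<lambda>x\<in>carrier V. c \<odot>\<^bsub>W\<^esub> f x)"
  by (simp_all add: Hom_def)

lemma module_Hom:
  assumes "module K V" "module K W"
  shows "module K (Hom K V W)"
proof -
  interpret V: module K V by fact
  interpret W: module K W by fact
  interpret F: module K "fun_module (carrier V) W" by (rule module_fun_module) fact
  have "submodule (hom_sp K V W) K (fun_module (carrier V) W)"
  proof (rule F.submoduleI')
    show "\<zero>\<^bsub>fun_module (carrier V) W\<^esub> \<in> hom_sp K V W"
      by (rule hom_spI) (auto simp: fun_module_def)
  next
    fix f g assume fg: "f \<in> hom_sp K V W" "g \<in> hom_sp K V W"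
    show "f \<oplus>\<^bsub>fun_module (carrier V) W\<^esub> g \<in> hom_sp K V W"
      by (rule hom_spI)
        (auto simp: fun_module_def hom_sp_closed[OF fg(1)] hom_sp_closed[OF fg(2)]
        hom_sp_add[OF fg(1)] hom_sp_add[OF fg(2)] hom_sp_smult[OF fg(1)] hom_sp_smult[OF fg(2)]
        W.a_ac W.smult_r_distr)
  next
    fix c f assume c: "c \<in> carrier K" and f: "f \<in> hom_sp K V W"
    \<comment> \<open>Commutativity of \<open>K\<close> is used here: \<open>c\<close> has to be
      moved past the scalar that tests linearity.\<close>
    show "c \<odot>\<^bsub>fun_module (carrier V) W\<^esub> f \<in> hom_sp K V W"
      by (rule hom_spI)
        (use c in \<open>auto simp: fun_module_def hom_sp_closed[OF f] hom_sp_add[OF f] hom_sp_smult[OF f]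
         W.smult_r_distr W.smult_assoc1[symmetric] V.R.m_comm\<close>)
  qed (auto simp: fun_module_def hom_sp_def)
  then show ?thesis
    unfolding Hom_eq_submodule by (rule submodule.submodule_is_module) (rule F.module_axioms)
qed

section \<open>Smallness in the universe\<close>

text \<open>Smallness speaks of subsets of \<open>'u\<close> only, while pairs, functions and cosets
  have other types. For these the right notion is a bijection onto a small set.\<close>

definition encodable :: "('u \<Rightarrow> 'u set) \<Rightarrow> 'a set \<Rightarrow> bool" where
  "encodable elts A \<longleftrightarrow> (\<exists>e. inj_on e A \<and> small elts (e ` A))"

lemma encodable_small: "small elts A \<Longrightarrow> encodable elts A"
  unfolding encodable_def by (rule exI[of _ "\<lambda>x. x"]) simp

locale universe =
  fixes elts :: "'u \<Rightarrow> 'u set"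
  assumes universe: "grothendieck_universe elts"
begin

lemma inj_elts: "inj elts"
  using universe by (simp add: grothendieck_universe_def)

lemma power_set: "\<exists>z. elts ` elts z = Pow (elts x)"
  using universe by (simp add: grothendieck_universe_def)

lemma small_subset:
  assumes "small elts A" "B \<subseteq> A" shows "small elts B"
proof -
  obtain a where a: "elts a = A" using assms(1) by (auto simp: small_def)
  obtain z where "elts ` elts z = Pow (elts a)" using power_set ..
  then have "B \<in> elts ` elts z" using assms(2) a by blast
  then show ?thesis by (auto simp: small_def)
qed

lemma small_UN:
  assumes "small elts I" "\<And>i. i \<in> I \<Longrightarrow> small elts (A i)"
  shows "small elts (\<Union>i\<in>I. A i)"
proof -
  obtain a where a: "elts a = I" using assms(1) by (auto simp: small_def)
  have "\<forall>i\<in>I. \<exists>z. elts z = A i" using assms(2) by (simp add: small_def)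
  then obtain f where f: "\<forall>i\<in>I. elts (f i) = A i" by metis
  obtain z where "elts z = (\<Union>i\<in>elts a. elts (f i))"
    using universe by (metis grothendieck_universe_def)
  then show ?thesis using a f by (auto simp: small_def)
qed

lemma small_doubleton: "small elts {x, y}"
  using universe by (simp add: small_def grothendieck_universe_def)

text \<open>Replacement is the union axiom for the family of singletons \<open>{f x}\<close>, each
  written as a degenerate pair.\<close>

lemma small_image: "small elts A \<Longrightarrow> small elts (f ` A)"
  using small_UN[of A "\<lambda>x. {f x, f x}", OF _ small_doubleton]
  by (simp add: UNION_singleton_eq_range)

text \<open>\<open>the_inv elts\<close> names a small set by the universe element having exactly
  these members. The power set axiom says that the names of the subsets of \<open>A\<close> are the
  members of one universe element.\<close>

lemma small_Pow_code:
  assumes "small elts A" shows "small elts (the_inv elts ` Pow A)"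
proof -
  obtain a where "elts a = A" using assms by (auto simp: small_def)
  then obtain z where "elts ` elts z = Pow A" using power_set[of a] by auto
  then have "the_inv elts ` Pow A = (\<lambda>x. the_inv elts (elts x)) ` elts z"
    by (simp add: image_image flip: \<open>elts ` elts z = Pow A\<close>)
  then have "the_inv elts ` Pow A = elts z"
    by (simp add: the_inv_f_f[OF inj_elts])
  then show ?thesis by (auto simp: small_def)
qed

lemma the_inv_elts_inject: "small elts A \<Longrightarrow> small elts B \<Longrightarrow> the_inv elts A = the_inv elts B \<longleftrightarrow> A = B"
  by (auto simp: small_def the_inv_f_f[OF inj_elts])

lemma encodable_inj:
  assumes "inj_on f A" "f ` A \<subseteq> B" "encodable elts B"
  shows "encodable elts A"
proof -
  obtain e where e: "inj_on e B" "small elts (e ` B)" using assms(3) by (auto simp: encodable_def)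
  have "inj_on (e \<circ> f) A"
    using assms e by (meson comp_inj_on inj_on_subset)
  moreover have "small elts ((e \<circ> f) ` A)"
    using assms(2) by (intro small_subset[OF e(2)]) auto
  ultimately show ?thesis by (auto simp: encodable_def)
qed

lemma encodable_subset: "encodable elts B \<Longrightarrow> A \<subseteq> B \<Longrightarrow> encodable elts A"
  by (rule encodable_inj[of "\<lambda>x. x"]) auto

text \<open>Choosing preimages embeds the image back into \<open>A\<close>.\<close>

lemma encodable_image: "encodable elts A \<Longrightarrow> encodable elts (f ` A)"
  by (rule encodable_inj[of "inv_into A f"]) (auto simp: inj_on_inv_into inv_into_into)

text \<open>A subset is encoded by the name of the set of codes of its elements.\<close>

lemma encodable_Pow:
  assumes "encodable elts A" shows "encodable elts (Pow A)"
proof -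
  obtain e where e: "inj_on e A" "small elts (e ` A)" using assms by (auto simp: encodable_def)
  have sm: "small elts (e ` S)" if "S \<subseteq> A" for S
    using that e(2) small_subset by blast
  have "inj_on (\<lambda>S. the_inv elts (e ` S)) (Pow A)"
    by (rule inj_onI) (metis PowD e(1) inj_on_image_eq_iff the_inv_elts_inject sm)
  moreover have "small elts ((\<lambda>S. the_inv elts (e ` S)) ` Pow A)"
    by (rule small_subset[OF small_Pow_code[OF e(2)]]) auto
  ultimately show ?thesis unfolding encodable_def by blast
qed

lemma encodable_Times:
  assumes "encodable elts A" "encodable elts B" shows "encodable elts (A \<times> B)"
proof -
  obtain d where d: "inj_on d A" "small elts (d ` A)" using assms(1) by (auto simp: encodable_def)
  obtain e where e: "inj_on e B" "small elts (e ` B)" using assms(2) by (auto simp: encodable_def)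
  define c where "c x y = the_inv elts {x, y}" for x y :: 'u
  have c: "c x y = c x' y' \<longleftrightarrow> {x, y} = {x', y'}" for x y x' y'
    by (simp add: c_def the_inv_elts_inject small_doubleton)
  \<comment> \<open>The Kuratowski pair {{x}, {x, y}}, with \<open>c\<close> naming unordered
    pairs.\<close>
  define p where "p x y = c (c x x) (c x y)" for x y
  have p: "p x y = p x' y' \<longleftrightarrow> x = x' \<and> y = y'" for x y x' y'
    by (auto simp: p_def c doubleton_eq_iff)
  let ?f = "\<lambda>(a, b). p (d a) (e b)"
  have "inj_on ?f (A \<times> B)"
    by (rule inj_onI) (use d(1) e(1) in \<open>auto simp: p dest: inj_onD\<close>)
  moreover have "small elts (\<Union>x\<in>d ` A. (\<lambda>y. p x y) ` e ` B)"
    using d(2) e(2) by (intro small_UN small_image)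
  then have "small elts (?f ` (A \<times> B))"
    by (rule small_subset) auto
  ultimately show ?thesis by (auto simp: encodable_def)
qed

text \<open>Extensional functions are determined by their graphs, which are subsets of
  \<open>A \<times> B\<close>.\<close>

lemma encodable_PiE:
  assumes "encodable elts A" "encodable elts B" shows "encodable elts (A \<rightarrow>\<^sub>E B)"
proof (rule encodable_inj)
  show "inj_on (\<lambda>f. (\<lambda>x. (x, f x)) ` A) (A \<rightarrow>\<^sub>E B)"
  proof (rule inj_onI)
    fix f g assume "f \<in> A \<rightarrow>\<^sub>E B" "g \<in> A \<rightarrow>\<^sub>E B" and "(\<lambda>x. (x, f x)) ` A = (\<lambda>x. (x, g x)) ` A"
    then show "f = g" by (intro PiE_ext[of f A "\<lambda>_. B" g]) auto
  qed
  show "(\<lambda>f. (\<lambda>x. (x, f x)) ` A) ` (A \<rightarrow>\<^sub>E B) \<subseteq> Pow (A \<times> B)" by auto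
  show "encodable elts (Pow (A \<times> B))" by (intro encodable_Pow encodable_Times assms)
qed

lemma encodable_Sigma:
  assumes "encodable elts I" "\<And>i. i \<in> I \<Longrightarrow> small elts (A i)"
  shows "encodable elts (Sigma I A)"
proof -
  obtain e where e: "inj_on e I" "small elts (e ` I)" using assms(1) by (auto simp: encodable_def)
  \<comment> \<open>The union axiom needs an index set in \<open>'u\<close>, so the union is
    reindexed by the codes of the elements of \<open>I\<close>.\<close>
  have "small elts (\<Union>x\<in>e ` I. A (inv_into I e x))"
    by (rule small_UN[OF e(2)]) (rule assms(2)[OF inv_into_into])
  moreover have "(\<Union>x\<in>e ` I. A (inv_into I e x)) = (\<Union>i\<in>I. A i)"
    using inv_into_f_f[OF e(1)] by simp
  ultimately have "encodable elts (I \<times> (\<Union>i\<in>I. A i))"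
    by (intro encodable_Times assms(1) encodable_small) simp
  then show ?thesis by (rule encodable_subset) auto
qed

text \<open>The cosets are renamed by elements of \<open>'u\<close>, since a member of
  \<open>Vect\<close> has its elements there. Afterwards only the surjection \<open>p\<close> and
  its kernel matter, so \<open>Q\<close> and \<open>p\<close> are obtained rather than
  defined.\<close>

lemma small_quotient:
  fixes K :: "('k, 'm) ring_scheme" and M :: "('k, 'a) module"
  assumes "module K M" "submodule N K M" "encodable elts (carrier M)"
  obtains Q p where "Q \<in> Vect K elts" "p \<in> hom_sp K M Q" "p ` carrier M = carrier Q"
    "\<And>x. x \<in> carrier M \<Longrightarrow> p x = \<zero>\<^bsub>Q\<^esub> \<longleftrightarrow> x \<in> N"
proof -
  interpret M: module K M by fact
  interpret N: abelian_subgroup N M by (rule M.submodule_abelian_subgroup) fact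
  have coset_eq: "N +>\<^bsub>M\<^esub> x = N +>\<^bsub>M\<^esub> y \<longleftrightarrow> x \<ominus>\<^bsub>M\<^esub> y \<in> N"
    if "x \<in> carrier M" "y \<in> carrier M" for x y
  proof -
    have "x \<ominus>\<^bsub>M\<^esub> y \<in> N \<longleftrightarrow> x \<in> N +>\<^bsub>M\<^esub> y"
      using that N.a_rcos_module[of y x] by (simp add: a_minus_def)
    also have "\<dots> \<longleftrightarrow> N +>\<^bsub>M\<^esub> x = N +>\<^bsub>M\<^esub> y"
      using that N.a_rcos_self[of x] N.a_repr_independence'[of x y] by auto
    finally show ?thesis by simp
  qed
  obtain e where e: "inj_on e ((\<lambda>x. N +>\<^bsub>M\<^esub> x) ` carrier M)"
    "small elts (e ` (\<lambda>x. N +>\<^bsub>M\<^esub> x) ` carrier M)"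
    using encodable_image[OF assms(3)] by (auto simp: encodable_def)
  define p where "p = (\<lambda>x\<in>carrier M. e (N +>\<^bsub>M\<^esub> x))"
  have p_eq: "p x = p y \<longleftrightarrow> x \<ominus>\<^bsub>M\<^esub> y \<in> N" if "x \<in> carrier M" "y \<in> carrier M" for x y
    using that coset_eq inj_on_eq_iff[OF e(1)] by (simp add: p_def)
  \<comment> \<open>\<open>s\<close> picks a representative of each named coset, and the operations
    of \<open>Q\<close> are computed on representatives. The choice is harmless because
    \<open>s (p x)\<close> and \<open>x\<close> differ by an element of \<open>N\<close>.\<close>
  define s where "s = inv_into (carrier M) p"
  have s: "s (p x) \<in> carrier M" "p (s (p x)) = p x" if "x \<in> carrier M" for x
    using that by (auto simp: s_def inv_into_into f_inv_into_f)
  define Q :: "('k, 'u) module" where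
    "Q = \<lparr>carrier = p ` carrier M, mult = undefined, one = undefined, zero = p \<zero>\<^bsub>M\<^esub>,
       add = (\<lambda>a b. p (s a \<oplus>\<^bsub>M\<^esub> s b)), smult = (\<lambda>c a. p (c \<odot>\<^bsub>M\<^esub> s a))\<rparr>"
  have add: "p x \<oplus>\<^bsub>Q\<^esub> p y = p (x \<oplus>\<^bsub>M\<^esub> y)" if xy: "x \<in> carrier M" "y \<in> carrier M" for x y
  proof -
    have "(s (p x) \<ominus>\<^bsub>M\<^esub> x) \<oplus>\<^bsub>M\<^esub> (s (p y) \<ominus>\<^bsub>M\<^esub> y) \<in> N"
      using xy s p_eq by (intro N.a_closed) auto
    also have "(s (p x) \<ominus>\<^bsub>M\<^esub> x) \<oplus>\<^bsub>M\<^esub> (s (p y) \<ominus>\<^bsub>M\<^esub> y) =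
        (s (p x) \<oplus>\<^bsub>M\<^esub> s (p y)) \<ominus>\<^bsub>M\<^esub> (x \<oplus>\<^bsub>M\<^esub> y)"
      using xy s by (simp add: a_minus_def M.minus_add M.a_ac)
    finally show ?thesis using xy s by (simp add: Q_def p_eq)
  qed
  have smult: "c \<odot>\<^bsub>Q\<^esub> p x = p (c \<odot>\<^bsub>M\<^esub> x)" if x: "c \<in> carrier K" "x \<in> carrier M" for c x
  proof -
    have "c \<odot>\<^bsub>M\<^esub> (s (p x) \<ominus>\<^bsub>M\<^esub> x) \<in> N"
      using x s p_eq by (intro M.submoduleE(4)[OF assms(2)]) auto
    also have "c \<odot>\<^bsub>M\<^esub> (s (p x) \<ominus>\<^bsub>M\<^esub> x) = c \<odot>\<^bsub>M\<^esub> s (p x) \<ominus>\<^bsub>M\<^esub> c \<odot>\<^bsub>M\<^esub> x"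
      using x s by (simp add: a_minus_def M.smult_r_distr M.smult_r_minus)
    finally show ?thesis using x s by (simp add: Q_def p_eq)
  qed
  show ?thesis
  proof (rule that)
    have "module K Q"
      by (rule module_epi[OF assms(1), of Q p]) (simp_all add: add smult, simp_all add: Q_def)
    moreover have "small elts (carrier Q)" using e(2) by (simp add: Q_def p_def image_image)
    ultimately show "Q \<in> Vect K elts" by (simp add: Vect_def)
    show "p \<in> hom_sp K M Q"
      by (rule hom_spI) (simp_all add: add smult, simp_all add: Q_def p_def)
    show "p ` carrier M = carrier Q" by (simp add: Q_def)
    fix x assume x: "x \<in> carrier M"
    have "\<ominus>\<^bsub>M\<^esub> \<zero>\<^bsub>M\<^esub> = \<zero>\<^bsub>M\<^esub>" by (rule M.minus_equality) simp_all
    then have "x \<ominus>\<^bsub>M\<^esub> \<zero>\<^bsub>M\<^esub> = x" using x by (simp add: a_minus_def)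
    moreover have "\<zero>\<^bsub>Q\<^esub> = p \<zero>\<^bsub>M\<^esub>" by (simp add: Q_def)
    ultimately show "p x = \<zero>\<^bsub>Q\<^esub> \<longleftrightarrow> x \<in> N" using p_eq[OF x M.zero_closed] by simp
  qed
qed

end

section \<open>Functors and the Yoneda lemma\<close>

text \<open>The set on the left is how induced maps on quotients are written: scalar multiplication
  in \<open>quot_module\<close>, with \<open>f\<close> scaling, and the arrows of
  \<open>quot_functor\<close>. Adding \<open>N'\<close> fills the image of a coset up to a whole
  coset, which is then the one represented by \<open>f x\<close>.\<close>

lemma coset_image:
  fixes M :: "('k, 'a) module" and M' :: "('k, 'b) module"
  assumes "module K M" "module K M'" "submodule N K M" "submodule N' K M'"
    and closed: "\<And>y. y \<in> carrier M \<Longrightarrow> f y \<in> carrier M'"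
    and add: "\<And>y z. \<lbrakk>y \<in> carrier M; z \<in> carrier M\<rbrakk> \<Longrightarrow> f (y \<oplus>\<^bsub>M\<^esub> z) = f y \<oplus>\<^bsub>M'\<^esub> f z"
    and sub: "f ` N \<subseteq> N'" and x: "x \<in> carrier M"
  shows "N' <+>\<^bsub>M'\<^esub> (f ` (N +>\<^bsub>M\<^esub> x)) = N' +>\<^bsub>M'\<^esub> f x"
proof -
  interpret M: module K M by fact
  interpret M': module K M' by fact
  note N = M.submoduleE[OF assms(3)] M.submodule_zero[OF assms(3)]
  note N' = M'.submoduleE[OF assms(4)]
  have 1: "n' \<oplus>\<^bsub>M'\<^esub> f (n \<oplus>\<^bsub>M\<^esub> x) = (n' \<oplus>\<^bsub>M'\<^esub> f n) \<oplus>\<^bsub>M'\<^esub> f x" "n' \<oplus>\<^bsub>M'\<^esub> f n \<in> N'"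
    if "n' \<in> N'" "n \<in> N" for n n'
  proof -
    have "n \<in> carrier M" "n' \<in> carrier M'" "f n \<in> N'" using that N(1) N'(1) sub by auto
    then show "n' \<oplus>\<^bsub>M'\<^esub> f (n \<oplus>\<^bsub>M\<^esub> x) = (n' \<oplus>\<^bsub>M'\<^esub> f n) \<oplus>\<^bsub>M'\<^esub> f x" "n' \<oplus>\<^bsub>M'\<^esub> f n \<in> N'"
      using x that N'(5) by (auto simp: add closed M'.a_assoc)
  qed
  have 2: "n' \<oplus>\<^bsub>M'\<^esub> f x = n' \<oplus>\<^bsub>M'\<^esub> f (\<zero>\<^bsub>M\<^esub> \<oplus>\<^bsub>M\<^esub> x)" for n' using x by simp
  show ?thesis
  proof (intro equalityI subsetI)
    fix y assume "y \<in> N' <+>\<^bsub>M'\<^esub> (f ` (N +>\<^bsub>M\<^esub> x))"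
    then obtain n n' where "n \<in> N" "n' \<in> N'" "y = n' \<oplus>\<^bsub>M'\<^esub> f (n \<oplus>\<^bsub>M\<^esub> x)"
      by (auto simp: set_add_def' a_r_coset_def')
    then show "y \<in> N' +>\<^bsub>M'\<^esub> f x" using 1 by (auto simp: a_r_coset_def')
  next
    fix y assume "y \<in> N' +>\<^bsub>M'\<^esub> f x"
    then obtain n' where "n' \<in> N'" "y = n' \<oplus>\<^bsub>M'\<^esub> f x" by (auto simp: a_r_coset_def')
    then show "y \<in> N' <+>\<^bsub>M'\<^esub> (f ` (N +>\<^bsub>M\<^esub> x))"
      using 2 N(7) by (auto simp: set_add_def' a_r_coset_def')
  qed
qed

text \<open>The set-valued operations are brought to representatives, the form that
  \<open>module_epi\<close> expects.\<close>

lemma quot_module_simps: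
  assumes "module K M" "submodule N K M"
  shows "carrier (quot_module M N) = (\<lambda>x. N +>\<^bsub>M\<^esub> x) ` carrier M"
    and "\<zero>\<^bsub>quot_module M N\<^esub> = N"
    and "\<lbrakk>x \<in> carrier M; y \<in> carrier M\<rbrakk> \<Longrightarrow>
      (N +>\<^bsub>M\<^esub> x) \<oplus>\<^bsub>quot_module M N\<^esub> (N +>\<^bsub>M\<^esub> y) = N +>\<^bsub>M\<^esub> (x \<oplus>\<^bsub>M\<^esub> y)"
    and "\<lbrakk>c \<in> carrier K; x \<in> carrier M\<rbrakk> \<Longrightarrow>
      c \<odot>\<^bsub>quot_module M N\<^esub> (N +>\<^bsub>M\<^esub> x) = N +>\<^bsub>M\<^esub> (c \<odot>\<^bsub>M\<^esub> x)"
proof -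
  interpret M: module K M by fact
  interpret N: abelian_subgroup N M by (rule M.submodule_abelian_subgroup) fact
  show "carrier (quot_module M N) = (\<lambda>x. N +>\<^bsub>M\<^esub> x) ` carrier M"
    by (auto simp: quot_module_def A_RCOSETS_def')
  show "\<zero>\<^bsub>quot_module M N\<^esub> = N" by (simp add: quot_module_def)
  show "(N +>\<^bsub>M\<^esub> x) \<oplus>\<^bsub>quot_module M N\<^esub> (N +>\<^bsub>M\<^esub> y) = N +>\<^bsub>M\<^esub> (x \<oplus>\<^bsub>M\<^esub> y)"
    if "x \<in> carrier M" "y \<in> carrier M"
    using that by (simp add: quot_module_def N.a_rcos_sum)
  show "c \<odot>\<^bsub>quot_module M N\<^esub> (N +>\<^bsub>M\<^esub> x) = N +>\<^bsub>M\<^esub> (c \<odot>\<^bsub>M\<^esub> x)"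
    if "c \<in> carrier K" "x \<in> carrier M"
    unfolding quot_module_def
    using that M.submoduleE(4)[OF assms(2)]
    by (simp, intro coset_image[OF assms(1,1,2,2)]) (auto simp: M.smult_r_distr)
qed

lemma module_quot_module:
  assumes "module K M" "submodule N K M"
  shows "module K (quot_module M N)"
proof (rule module_epi[OF assms(1), where p = "\<lambda>x. N +>\<^bsub>M\<^esub> x"])
  interpret M: module K M by fact
  show "\<zero>\<^bsub>quot_module M N\<^esub> = N +>\<^bsub>M\<^esub> \<zero>\<^bsub>M\<^esub>"
    using M.submoduleE(1)[OF assms(2)] by (simp add: quot_module_simps[OF assms])
qed (simp_all add: quot_module_simps[OF assms])

section \<open>Functors, natural transformations and representables\<close>

lemma Vect_module: "V \<in> Vect K elts \<Longrightarrow> module K V"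
  by (simp add: Vect_def)

lemma Vect_small: "V \<in> Vect K elts \<Longrightarrow> small elts (carrier V)"
  by (simp add: Vect_def)

lemma
  assumes "X \<in> Functors K elts" and V: "V \<in> Vect K elts"
  shows Functors_Ob: "Ob X V \<in> Vect K elts"
    and Functors_id: "x \<in> carrier (Ob X V) \<Longrightarrow> Ar X V V (\<lambda>x\<in>carrier V. x) x = x"
  using assms by (auto simp: Functors_def)

lemma
  assumes X: "X \<in> Functors K elts" and V: "V \<in> Vect K elts" and W: "W \<in> Vect K elts"
    and f: "f \<in> hom_sp K V W"
  shows Functors_Ar: "Ar X V W f \<in> hom_sp K (Ob X V) (Ob X W)"
    and Functors_add: "\<lbrakk>g \<in> hom_sp K V W; x \<in> carrier (Ob X V)\<rbrakk> \<Longrightarrow>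
      Ar X V W (f \<oplus>\<^bsub>Hom K V W\<^esub> g) x = Ar X V W f x \<oplus>\<^bsub>Ob X W\<^esub> Ar X V W g x"
    and Functors_smult: "\<lbrakk>c \<in> carrier K; x \<in> carrier (Ob X V)\<rbrakk> \<Longrightarrow>
      Ar X V W (c \<odot>\<^bsub>Hom K V W\<^esub> f) x = c \<odot>\<^bsub>Ob X W\<^esub> Ar X V W f x"
    and Functors_comp: "\<lbrakk>U \<in> Vect K elts; h \<in> hom_sp K U V; x \<in> carrier (Ob X U)\<rbrakk> \<Longrightarrow>
      Ar X U W (compose (carrier U) f h) x = Ar X V W f (Ar X U V h x)"
proof -
  \<comment> \<open>Linearity of a functor is stated for its restricted action, so sums and
    multiples of maps must be known to lie in \<open>hom_sp\<close>; the module structure of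
    \<open>Hom\<close> provides this.\<close>
  interpret H: module K "Hom K V W" by (intro module_Hom Vect_module[OF V] Vect_module[OF W])
  have *: "restrict (Ar X V W) (hom_sp K V W) \<in> hom_sp K (Hom K V W) (Hom K (Ob X V) (Ob X W))"
    using X V W by (auto simp: Functors_def)
  show "Ar X V W f \<in> hom_sp K (Ob X V) (Ob X W)"
    using hom_sp_closed[OF *, of f] f by simp
  show "Ar X V W (f \<oplus>\<^bsub>Hom K V W\<^esub> g) x = Ar X V W f x \<oplus>\<^bsub>Ob X W\<^esub> Ar X V W g x"
    if "g \<in> hom_sp K V W" "x \<in> carrier (Ob X V)"
  proof -
    have "f \<oplus>\<^bsub>Hom K V W\<^esub> g \<in> hom_sp K V W" using H.add.m_closed[of f g] f that by simp
    then show ?thesis using hom_sp_add[OF *, of f g] f that by simp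
  qed
  show "Ar X V W (c \<odot>\<^bsub>Hom K V W\<^esub> f) x = c \<odot>\<^bsub>Ob X W\<^esub> Ar X V W f x"
    if "c \<in> carrier K" "x \<in> carrier (Ob X V)"
  proof -
    have "c \<odot>\<^bsub>Hom K V W\<^esub> f \<in> hom_sp K V W" using H.smult_closed[of c f] f that by simp
    then show ?thesis using hom_sp_smult[OF *, of c f] f that by simp
  qed
  show "Ar X U W (compose (carrier U) f h) x = Ar X V W f (Ar X U V h x)"
    if "U \<in> Vect K elts" "h \<in> hom_sp K U V" "x \<in> carrier (Ob X U)"
  proof -
    have "Ar X U W (compose (carrier U) f h) =
        compose (carrier (Ob X U)) (Ar X V W f) (Ar X U V h)"
      using X V W f that by (simp add: Functors_def)
    then show ?thesis using that(3) by (simp add: compose_def)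
  qed
qed

lemma
  assumes "\<eta> \<in> Nat K elts X Y" and "V \<in> Vect K elts"
  shows Nat_hom: "\<eta> V \<in> hom_sp K (Ob X V) (Ob Y V)"
    and Nat_natural: "\<lbrakk>W \<in> Vect K elts; f \<in> hom_sp K V W; x \<in> carrier (Ob X V)\<rbrakk> \<Longrightarrow>
      \<eta> W (Ar X V W f x) = Ar Y V W f (\<eta> V x)"
  using assms by (auto simp: Nat_def PiE_iff)

lemma Yo_simps [simp]:
  "Ob (Yo K V) W = Hom K V W"
  "g \<in> hom_sp K V W \<Longrightarrow> Ar (Yo K V) W W' f g = compose (carrier V) f g"
  by (simp_all add: Yo_def)

lemma
  assumes "subspace_filter K V F"
  shows filter_nonempty: "F \<noteq> {}"
    and filter_submodule: "H \<in> F \<Longrightarrow> submodule H K V"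
    and filter_Int: "\<lbrakk>H \<in> F; H' \<in> F\<rbrakk> \<Longrightarrow> H \<inter> H' \<in> F"
proof -
  note F = assms[unfolded subspace_filter_def]
  show "F \<noteq> {}" by (rule F[THEN conjunct1])
  show "submodule H K V" if "H \<in> F"
    by (rule F[THEN conjunct2, THEN conjunct1, THEN bspec, OF that])
  show "H \<inter> H' \<in> F" if "H \<in> F" "H' \<in> F"
    by (rule F[THEN conjunct2, THEN conjunct2, THEN conjunct1, THEN bspec, THEN bspec, OF that])
qed

text \<open>The union is directed: if \<open>f\<close> vanishes on \<open>H\<close> and
  \<open>g\<close> on \<open>H'\<close>, both vanish on \<open>H \<inter> H'\<close>, which is again
  in the filter.\<close>

lemma submodule_vanishing:
  assumes V: "module K V" and W: "module K W" and F: "subspace_filter K V F"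
  shows "submodule (\<Union>H\<in>F. Yo_vanishing K V H W) K (Hom K V W)"
proof -
  interpret V: module K V by fact
  interpret W: module K W by fact
  interpret H: module K "Hom K V W" using V W by (rule module_Hom)
  have sub: "H \<subseteq> carrier V" if "H \<in> F" for H
    by (rule V.submoduleE(1)[OF filter_submodule[OF F that]])
  show ?thesis
  proof (rule H.submoduleI')
    obtain H where "H \<in> F" using filter_nonempty[OF F] by auto
    then show "\<zero>\<^bsub>Hom K V W\<^esub> \<in> (\<Union>H\<in>F. Yo_vanishing K V H W)"
      using H.zero_closed sub by (auto simp: Yo_vanishing_def)
  next
    fix f g assume "f \<in> (\<Union>H\<in>F. Yo_vanishing K V H W)" "g \<in> (\<Union>H\<in>F. Yo_vanishing K V H W)"
    then obtain H H' where *: "H \<in> F" "H' \<in> F" "f \<in> Yo_vanishing K V H W" "g \<in> Yo_vanishing K V H' W"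
      by auto
    then have "H \<inter> H' \<in> F" by (intro filter_Int[OF F])
    moreover have "f \<oplus>\<^bsub>Hom K V W\<^esub> g \<in> Yo_vanishing K V (H \<inter> H') W"
    proof -
      have "f \<oplus>\<^bsub>Hom K V W\<^esub> g \<in> hom_sp K V W"
        using * H.add.m_closed[of f g] by (simp add: Yo_vanishing_def)
      moreover have "(f \<oplus>\<^bsub>Hom K V W\<^esub> g) x = \<zero>\<^bsub>W\<^esub>" if "x \<in> H \<inter> H'" for x
        using * that subsetD[OF sub[OF *(1)], of x] by (simp add: Yo_vanishing_def)
      ultimately show ?thesis unfolding Yo_vanishing_def by blast
    qed
    ultimately show "f \<oplus>\<^bsub>Hom K V W\<^esub> g \<in> (\<Union>H\<in>F. Yo_vanishing K V H W)" by blast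
  next
    fix c f assume c: "c \<in> carrier K" and "f \<in> (\<Union>H\<in>F. Yo_vanishing K V H W)"
    then obtain H where *: "H \<in> F" "f \<in> Yo_vanishing K V H W" by auto
    then have "c \<odot>\<^bsub>Hom K V W\<^esub> f \<in> Yo_vanishing K V H W"
    proof -
      have "c \<odot>\<^bsub>Hom K V W\<^esub> f \<in> hom_sp K V W"
        using * c H.smult_closed[of c f] by (simp add: Yo_vanishing_def)
      moreover have "(c \<odot>\<^bsub>Hom K V W\<^esub> f) x = \<zero>\<^bsub>W\<^esub>" if "x \<in> H" for x
        using * that c subsetD[OF sub[OF *(1)], of x] by (simp add: Yo_vanishing_def)
      ultimately show ?thesis unfolding Yo_vanishing_def by blast
    qed
    then show "c \<odot>\<^bsub>Hom K V W\<^esub> f \<in> (\<Union>H\<in>F. Yo_vanishing K V H W)" using * by blast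
  qed (auto simp: Yo_vanishing_def)
qed

text \<open>The reason why the vanishing maps form a subfunctor of \<open>Yo K V\<close>.\<close>

lemma vanishing_compose:
  assumes "module K V" "module K W" "module K W'" "f \<in> hom_sp K W W'" "g \<in> Yo_vanishing K V H W" "H \<subseteq> carrier V"
  shows "compose (carrier V) f g \<in> Yo_vanishing K V H W'"
  using assms(5,6) hom_sp_compose[OF assms(1) _ assms(4), of g] hom_sp_zero[OF assms(2-4)]
  by (auto simp: Yo_vanishing_def compose_def)

text \<open>A natural transformation out of the quotient of \<open>Yo K V\<close> is determined by
  its value \<open>x\<close> at the class of the identity of \<open>V\<close>, and \<open>x\<close>
  can be any element killed by the subfunctor. All transformations are zero exactly when all such
  \<open>x\<close> are.\<close>

lemma Q4_free_iff:
  fixes X :: "('k, 'u, 'u) vfunctor"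
  assumes X: "X \<in> Functors K elts"
  shows "Q4_free K elts X \<longleftrightarrow>
    (\<forall>V\<in>Vect K elts. \<forall>F. subspace_filter K V F \<longrightarrow> \<Inter>F = {\<zero>\<^bsub>V\<^esub>} \<longrightarrow>
       (\<forall>x\<in>carrier (Ob X V).
          (\<forall>W\<in>Vect K elts. \<forall>H\<in>F. \<forall>f\<in>Yo_vanishing K V H W. Ar X V W f x = \<zero>\<^bsub>Ob X W\<^esub>) \<longrightarrow>
          x = \<zero>\<^bsub>Ob X V\<^esub>))"
    (is "_ \<longleftrightarrow> (\<forall>V\<in>_. \<forall>F. _ \<longrightarrow> _ \<longrightarrow> ?P V F)")
proof -
  have main: "(let Q = quot_functor (Yo K V) (\<lambda>W. \<Union>H\<in>F. Yo_vanishing K V H W) in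
         \<forall>\<eta>\<in>Nat K elts Q X. \<forall>W\<in>Vect K elts. \<forall>A\<in>carrier (Ob Q W). \<eta> W A = \<zero>\<^bsub>Ob X W\<^esub>) \<longleftrightarrow> ?P V F"
    (is "?Q \<longleftrightarrow> _")
    if V: "V \<in> Vect K elts" and F: "subspace_filter K V F" for V F
  proof -
    define N where "N W = (\<Union>H\<in>F. Yo_vanishing K V H W)" for W :: "('k, 'u) module"
    define Q where "Q = quot_functor (Yo K V) N"
    define c where "c W f = N W +>\<^bsub>Hom K V W\<^esub> f" for W f
    let ?i = "\<lambda>x\<in>carrier V. x"
    note mV = Vect_module[OF V]
    have mH: "module K (Hom K V W)" if "W \<in> Vect K elts" for W
      by (rule module_Hom[OF mV Vect_module[OF that]])
    have mX: "module K (Ob X W)" if "W \<in> Vect K elts" for W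
      by (rule Vect_module[OF Functors_Ob[OF X that]])
    have sN: "submodule (N W) K (Hom K V W)" if "W \<in> Vect K elts" for W
      unfolding N_def by (rule submodule_vanishing[OF mV Vect_module[OF that] F])
    have Q_Ob: "Ob Q W = quot_module (Hom K V W) (N W)" for W
      by (simp add: Q_def quot_functor_def)
    have sub: "H \<subseteq> carrier V" if "H \<in> F" for H
      by (rule module.submoduleE(1)[OF mV filter_submodule[OF F that]])
    have comp: "compose (carrier V) f g \<in> hom_sp K V W'"
      if "f \<in> hom_sp K W W'" "g \<in> hom_sp K V W" for f g W W'
      by (rule hom_sp_compose[OF mV that(2,1)])
    have comp_N: "compose (carrier V) f g \<in> N W'"
      if "W \<in> Vect K elts" "W' \<in> Vect K elts" "f \<in> hom_sp K W W'" "g \<in> N W" for f g W W'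
    proof -
      from that(4) obtain H where "H \<in> F" "g \<in> Yo_vanishing K V H W" by (auto simp: N_def)
      then show ?thesis
        using vanishing_compose[OF mV Vect_module[OF that(1)] Vect_module[OF that(2)] that(3), of g H] sub
        unfolding N_def by blast
    qed
    have Q_simps: "carrier (Ob Q W) = c W ` hom_sp K V W" "\<zero>\<^bsub>Ob Q W\<^esub> = N W"
      "\<And>f g. \<lbrakk>f \<in> hom_sp K V W; g \<in> hom_sp K V W\<rbrakk> \<Longrightarrow> c W f \<oplus>\<^bsub>Ob Q W\<^esub> c W g = c W (f \<oplus>\<^bsub>Hom K V W\<^esub> g)"
      "\<And>k f. \<lbrakk>k \<in> carrier K; f \<in> hom_sp K V W\<rbrakk> \<Longrightarrow> k \<odot>\<^bsub>Ob Q W\<^esub> c W f = c W (k \<odot>\<^bsub>Hom K V W\<^esub> f)"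
      if "W \<in> Vect K elts" for W
      using quot_module_simps[OF mH[OF that] sN[OF that]] unfolding Q_Ob c_def by simp_all
    have Q_Ar: "Ar Q W W' f (c W g) = c W' (compose (carrier V) f g)"
      if W: "W \<in> Vect K elts" "W' \<in> Vect K elts" and f: "f \<in> hom_sp K W W'" and g: "g \<in> hom_sp K V W"
      for W W' f g
    proof -
      interpret H: module K "Hom K V W" by (rule mH) fact
      have "c W g \<in> carrier (quot_module (Hom K V W) (N W))"
        using Q_simps(1)[OF W(1)] g by (simp add: Q_Ob)
      then have "Ar Q W W' f (c W g) = N W' <+>\<^bsub>Hom K V W'\<^esub> (Ar (Yo K V) W W' f ` c W g)"
        by (simp add: Q_def quot_functor_def)
      also have "Ar (Yo K V) W W' f ` c W g = (\<lambda>g. compose (carrier V) f g) ` c W g"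
      proof (rule image_cong[OF refl])
        fix h assume "h \<in> c W g"
        then have "h \<in> hom_sp K V W"
          using H.a_r_coset_subset_G[of "N W" g] H.submoduleE(1)[OF sN[OF W(1)]] g
          by (auto simp: c_def)
        then show "Ar (Yo K V) W W' f h = compose (carrier V) f h" by simp
      qed
      also have "N W' <+>\<^bsub>Hom K V W'\<^esub> \<dots> = c W' (compose (carrier V) f g)"
        unfolding c_def
      proof (rule coset_image[OF mH[OF W(1)] mH[OF W(2)] sN[OF W(1)] sN[OF W(2)]])
        fix h h' assume "h \<in> carrier (Hom K V W)" "h' \<in> carrier (Hom K V W)"
        then show "compose (carrier V) f (h \<oplus>\<^bsub>Hom K V W\<^esub> h') =
          compose (carrier V) f h \<oplus>\<^bsub>Hom K V W'\<^esub> compose (carrier V) f h'"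
          by (auto simp: compose_def hom_sp_add[OF f] hom_sp_closed)
      qed (use comp[OF f] comp_N[OF W f] g in auto)
      finally show ?thesis .
    qed
    have c_eq: "c W f = N W" if "W \<in> Vect K elts" "f \<in> N W" for W f
    proof -
      interpret H: module K "Hom K V W" by (rule mH) fact
      interpret N: abelian_subgroup "N W" "Hom K V W"
        by (rule H.submodule_abelian_subgroup[OF sN]) fact
      show ?thesis unfolding c_def by (rule N.a_rcos_const) fact
    qed
    have i: "?i \<in> hom_sp K V V" by (rule hom_sp_id[OF mV])
    have comp_i: "compose (carrier V) f ?i = f" if "f \<in> hom_sp K V W" for f W
      using hom_sp_ext[OF that] by (auto simp: compose_def intro!: extensionalityI[of _ "carrier V"])
    have "?P V F" if ?Q
    proof (intro ballI impI)
      fix x assume x: "x \<in> carrier (Ob X V)"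
        and "\<forall>W\<in>Vect K elts. \<forall>H\<in>F. \<forall>f\<in>Yo_vanishing K V H W. Ar X V W f x = \<zero>\<^bsub>Ob X W\<^esub>"
      then have van: "Ar X V W f x = \<zero>\<^bsub>Ob X W\<^esub>" if "W \<in> Vect K elts" "f \<in> N W" for W f
        using that by (auto simp: N_def)
      \<comment> \<open>The transformation belonging to \<open>x\<close>, computed on an arbitrary
        representative of a coset. Two representatives differ by a map in \<open>N W\<close>, which
        kills \<open>x\<close>, and \<open>X\<close> is additive on hom-spaces, so the choice does
        not matter.\<close>
      define \<eta> where "\<eta> = (\<lambda>W\<in>Vect K elts. \<lambda>A\<in>carrier (Ob Q W). Ar X V W (SOME f. f \<in> A) x)"
      have \<eta>: "\<eta> W (c W f) = Ar X V W f x" if W: "W \<in> Vect K elts" and f: "f \<in> hom_sp K V W" for W f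
      proof -
        interpret H: module K "Hom K V W" by (rule mH) fact
        interpret N: abelian_subgroup "N W" "Hom K V W"
          by (rule H.submodule_abelian_subgroup[OF sN]) fact
        interpret XW: module K "Ob X W" by (rule mX) fact
        have "f \<in> c W f" unfolding c_def using f by (intro N.a_rcos_self) simp
        then have "(SOME f'. f' \<in> c W f) \<in> c W f"
          by (rule someI[where P = "\<lambda>f'. f' \<in> c W f"])
        then obtain n where n: "n \<in> N W" "(SOME f'. f' \<in> c W f) = n \<oplus>\<^bsub>Hom K V W\<^esub> f"
          by (auto simp: c_def a_r_coset_def')
        have "n \<in> hom_sp K V W" using n(1) N.a_subset by auto
        then have "Ar X V W (SOME f'. f' \<in> c W f) x = Ar X V W n x \<oplus>\<^bsub>Ob X W\<^esub> Ar X V W f x"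
          unfolding n(2) using Functors_add[OF X V W] f x by blast
        also have "\<dots> = Ar X V W f x"
          using van[OF W n(1)] hom_sp_closed[OF Functors_Ar[OF X V W f] x] by simp
        finally show ?thesis
          using W f by (simp add: \<eta>_def Q_simps(1)[OF W])
      qed
      have "\<eta> \<in> Nat K elts Q X"
        unfolding Nat_def
      proof (intro CollectI conjI PiE_I ballI)
        fix W assume W: "W \<in> Vect K elts"
        interpret H: module K "Hom K V W" by (rule mH) fact
        show "\<eta> W \<in> hom_sp K (Ob Q W) (Ob X W)"
        proof (rule hom_spI)
          show "\<eta> W \<in> extensional (carrier (Ob Q W))" using W by (simp add: \<eta>_def)
          fix A assume "A \<in> carrier (Ob Q W)"
          then obtain f where f: "f \<in> hom_sp K V W" "A = c W f" by (auto simp: Q_simps(1)[OF W])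
          then show "\<eta> W A \<in> carrier (Ob X W)"
            using hom_sp_closed[OF Functors_Ar[OF X V W f(1)] x] by (simp add: \<eta>[OF W])
          {
            fix B assume "B \<in> carrier (Ob Q W)"
            then obtain g where g: "g \<in> hom_sp K V W" "B = c W g" by (auto simp: Q_simps(1)[OF W])
            have "f \<oplus>\<^bsub>Hom K V W\<^esub> g \<in> hom_sp K V W" using H.add.m_closed[of f g] f g by simp
            then show "\<eta> W (A \<oplus>\<^bsub>Ob Q W\<^esub> B) = \<eta> W A \<oplus>\<^bsub>Ob X W\<^esub> \<eta> W B"
              using f g Functors_add[OF X V W f(1) g(1) x]
              by (simp add: Q_simps(3)[OF W] \<eta>[OF W] del: Hom_simps)
          next
            fix k assume k: "k \<in> carrier K"
            have "k \<odot>\<^bsub>Hom K V W\<^esub> f \<in> hom_sp K V W" using H.smult_closed[of k f] f k by simp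
            then show "\<eta> W (k \<odot>\<^bsub>Ob Q W\<^esub> A) = k \<odot>\<^bsub>Ob X W\<^esub> \<eta> W A"
              using f k Functors_smult[OF X V W f(1) k x]
              by (simp add: Q_simps(4)[OF W] \<eta>[OF W] del: Hom_simps)
          }
        qed
        fix W' f A assume W': "W' \<in> Vect K elts" and f: "f \<in> hom_sp K W W'" and "A \<in> carrier (Ob Q W)"
        then obtain g where g: "g \<in> hom_sp K V W" "A = c W g" by (auto simp: Q_simps(1)[OF W])
        show "\<eta> W' (Ar Q W W' f A) = Ar X W W' f (\<eta> W A)"
          using Functors_comp[OF X W W' f V g(1) x]
          by (simp add: g(2) Q_Ar[OF W W' f g(1)] \<eta>[OF W g(1)] \<eta>[OF W' comp[OF f g(1)]])
      qed (simp add: \<eta>_def)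
      moreover have "c V ?i \<in> carrier (Ob Q V)" using i by (simp add: Q_simps(1)[OF V])
      ultimately have "\<eta> V (c V ?i) = \<zero>\<^bsub>Ob X V\<^esub>"
        using that V unfolding Let_def N_def[symmetric] Q_def[symmetric] by blast
      then show "x = \<zero>\<^bsub>Ob X V\<^esub>" using \<eta>[OF V i] Functors_id[OF X V x] by simp
    qed
    moreover have ?Q if P: "?P V F"
      unfolding Let_def N_def[symmetric] Q_def[symmetric]
    proof (intro ballI)
      fix \<eta> W A assume \<eta>: "\<eta> \<in> Nat K elts Q X" and W: "W \<in> Vect K elts" and "A \<in> carrier (Ob Q W)"
      then obtain f where f: "f \<in> hom_sp K V W" "A = c W f" by (auto simp: Q_simps(1)[OF W])
      define x where "x = \<eta> V (c V ?i)"
      have iQ: "c V ?i \<in> carrier (Ob Q V)" using i by (simp add: Q_simps(1)[OF V])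
      have x: "x \<in> carrier (Ob X V)"
        unfolding x_def by (rule hom_sp_closed[OF Nat_hom[OF \<eta> V] iQ])
      \<comment> \<open>Naturality along \<open>g\<close>, applied to the class of the
        identity.\<close>
      have eq: "Ar X V U g x = \<eta> U (c U g)" if U: "U \<in> Vect K elts" and g: "g \<in> hom_sp K V U" for U g
        using Nat_natural[OF \<eta> V U g iQ] by (simp add: x_def Q_Ar[OF V U g i] comp_i[OF g])
      have "Ar X V U g x = \<zero>\<^bsub>Ob X U\<^esub>" if U: "U \<in> Vect K elts" and H: "H \<in> F" and g: "g \<in> Yo_vanishing K V H U"
        for U H g
      proof -
        have "g \<in> hom_sp K V U" using g by (simp add: Yo_vanishing_def)
        moreover have "c U g = \<zero>\<^bsub>Ob Q U\<^esub>"
          using c_eq[OF U, of g] g H by (auto simp: N_def Q_simps(2)[OF U])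
        moreover have "\<eta> U \<zero>\<^bsub>Ob Q U\<^esub> = \<zero>\<^bsub>Ob X U\<^esub>"
          by (rule hom_sp_zero[OF _ mX[OF U] Nat_hom[OF \<eta> U]])
            (simp add: Q_Ob module_quot_module[OF mH[OF U] sN[OF U]])
        ultimately show ?thesis using eq[OF U] by simp
      qed
      then have "x = \<zero>\<^bsub>Ob X V\<^esub>" using P x by blast
      then show "\<eta> W A = \<zero>\<^bsub>Ob X W\<^esub>"
        using eq[OF W f(1)] f(2) hom_sp_zero[OF mX[OF V] mX[OF W] Functors_Ar[OF X V W f(1)]] by simp
    qed
    ultimately show ?thesis by blast
  qed
  show ?thesis
    unfolding Q4_free_def using main by (intro ball_cong[OF refl] all_cong1 imp_cong) simp_all
qed

section \<open>Directed colimits of representables\<close>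

lemma
  assumes "directed_poset I r"
  shows directed_refl: "i \<in> I \<Longrightarrow> (i, i) \<in> r"
    and directed_trans: "\<lbrakk>(i, j) \<in> r; (j, k) \<in> r\<rbrakk> \<Longrightarrow> (i, k) \<in> r"
    and directed_field: "(i, j) \<in> r \<Longrightarrow> i \<in> I \<and> j \<in> I"
    and directed_nonempty: "I \<noteq> {}"
    and directed_bound: "\<lbrakk>i \<in> I; j \<in> I\<rbrakk> \<Longrightarrow> \<exists>k\<in>I. (i, k) \<in> r \<and> (j, k) \<in> r"
  using assms unfolding directed_poset_def partial_order_on_def preorder_on_def refl_on_def
  by (blast dest: transD)+

lemma directed_prod:
  assumes r: "directed_poset I r" and s: "directed_poset J s"
  shows "directed_poset (I \<times> J) (prod_rel r s)"
proof -
  have "antisym r" "antisym s" using r s by (auto simp: directed_poset_def partial_order_on_def)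
  then have "antisym (prod_rel r s)" by (auto simp: antisym_def prod_rel_def)
  moreover have "trans (prod_rel r s)"
    using directed_trans[OF r] directed_trans[OF s] unfolding trans_def prod_rel_def by blast
  moreover have "prod_rel r s \<subseteq> (I \<times> J) \<times> (I \<times> J)"
    using directed_field[OF r] directed_field[OF s] by (auto simp: prod_rel_def)
  moreover have "refl_on (I \<times> J) (prod_rel r s)"
    using directed_refl[OF r] directed_refl[OF s] by (auto simp: refl_on_def prod_rel_def)
  moreover have "I \<times> J \<noteq> {}" using directed_nonempty[OF r] directed_nonempty[OF s] by simp
  moreover have "\<exists>z\<in>I \<times> J. (x, z) \<in> prod_rel r s \<and> (y, z) \<in> prod_rel r s"
    if "x \<in> I \<times> J" "y \<in> I \<times> J" for x y
  proof -
    obtain i j i' j' where xy: "x = (i, j)" "y = (i', j')" by (cases x, cases y)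
    have ij: "i \<in> I" "i' \<in> I" "j \<in> J" "j' \<in> J" using that xy by auto
    obtain k where "k \<in> I" "(i, k) \<in> r" "(i', k) \<in> r"
      using directed_bound[OF r ij(1,2)] by blast
    moreover obtain l where "l \<in> J" "(j, l) \<in> s" "(j', l) \<in> s"
      using directed_bound[OF s ij(3,4)] by blast
    ultimately show ?thesis unfolding xy prod_rel_def by blast
  qed
  ultimately show ?thesis
    by (simp add: directed_poset_def partial_order_on_def preorder_on_def)
qed

lemma
  assumes "op_diagram K elts I r F \<phi>"
  shows op_diagram_Ob: "i \<in> I \<Longrightarrow> F i \<in> Vect K elts"
    and op_diagram_hom: "(i, j) \<in> r \<Longrightarrow> \<phi> i j \<in> hom_sp K (F j) (F i)"
    and op_diagram_comp: "\<lbrakk>(i, j) \<in> r; (j, k) \<in> r; x \<in> carrier (F k)\<rbrakk> \<Longrightarrow> \<phi> i k x = \<phi> i j (\<phi> j k x)"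
proof -
  note * = assms[unfolded op_diagram_def]
  show "F i \<in> Vect K elts" if "i \<in> I" using * that by blast
  show "\<phi> i j \<in> hom_sp K (F j) (F i)" if "(i, j) \<in> r" using * that by blast
  show "\<phi> i k x = \<phi> i j (\<phi> j k x)" if "(i, j) \<in> r" "(j, k) \<in> r" "x \<in> carrier (F k)"
  proof -
    have "\<phi> i k = compose (carrier (F k)) (\<phi> i j) (\<phi> j k)" using * that by blast
    then show ?thesis using that(3) by (simp add: compose_eq)
  qed
qed

lemma op_diagram_id:
  assumes "op_diagram K elts I r F \<phi>" "i \<in> I" "x \<in> carrier (F i)"
  shows "\<phi> i i x = x"
proof -
  have "\<phi> i i = (\<lambda>x\<in>carrier (F i). x)" using assms(1,2) unfolding op_diagram_def by blast
  then show ?thesis using assms(3) by simp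
qed

lemma
  assumes "is_cocone K elts I r F \<phi> X \<kappa>"
  shows cocone_functor: "X \<in> Functors K elts"
    and cocone_Nat: "i \<in> I \<Longrightarrow> \<kappa> i \<in> Nat K elts (Yo K (F i)) X"
    and cocone_comp: "\<lbrakk>(i, j) \<in> r; V \<in> Vect K elts; g \<in> hom_sp K (F i) V\<rbrakk> \<Longrightarrow>
      \<kappa> j V (compose (carrier (F j)) g (\<phi> i j)) = \<kappa> i V g"
  using assms unfolding is_cocone_def by blast+

lemma
  assumes "is_cocone K elts I r F \<phi> X \<kappa>" "i \<in> I" "V \<in> Vect K elts"
  shows cocone_hom: "\<kappa> i V \<in> hom_sp K (Hom K (F i) V) (Ob X V)"
    and cocone_closed: "g \<in> hom_sp K (F i) V \<Longrightarrow> \<kappa> i V g \<in> carrier (Ob X V)"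
    and cocone_natural: "\<lbrakk>W \<in> Vect K elts; f \<in> hom_sp K V W; g \<in> hom_sp K (F i) V\<rbrakk> \<Longrightarrow>
      \<kappa> i W (compose (carrier (F i)) f g) = Ar X V W f (\<kappa> i V g)"
proof -
  note N = cocone_Nat[OF assms(1,2)]
  show h: "\<kappa> i V \<in> hom_sp K (Hom K (F i) V) (Ob X V)" using Nat_hom[OF N assms(3)] by simp
  show "\<kappa> i V g \<in> carrier (Ob X V)" if "g \<in> hom_sp K (F i) V"
    using hom_sp_closed[OF h, of g] that by simp
  show "\<kappa> i W (compose (carrier (F i)) f g) = Ar X V W f (\<kappa> i V g)"
    if "W \<in> Vect K elts" "f \<in> hom_sp K V W" "g \<in> hom_sp K (F i) V"
    using Nat_natural[OF N assms(3) that(1,2), of g] that(3) by simp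
qed

context universe
begin

text \<open>
  The functor \<open>W \<mapsto> W\<^bsup>A\<^esup>\<close> modulo families that vanish eventually, with \<open>A\<close> the disjoint union of the \<open>S i\<close>.
  A colimit of representables need not be constructed: mapping it to this functor, for
  \<open>S i = carrier (F i)\<close>, already shows that a germ is zero only if it vanishes eventually.
\<close>

lemma reduced_power_functor:
  fixes K :: "('k, 'm) ring_scheme" and I :: "'i set" and S :: "'i \<Rightarrow> 'u set"
  defines "A \<equiv> Sigma I S"
  assumes dir: "directed_poset I r" and I: "encodable elts I" and S: "\<And>i. i \<in> I \<Longrightarrow> small elts (S i)"
  obtains Z :: "('k, 'u, 'u) vfunctor" and p where
    "Z \<in> Functors K elts"
    "\<And>W. W \<in> Vect K elts \<Longrightarrow> p W \<in> hom_sp K (fun_module A W) (Ob Z W)"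
    "\<And>V W f u. \<lbrakk>V \<in> Vect K elts; W \<in> Vect K elts; f \<in> hom_sp K V W; u \<in> carrier (fun_module A V)\<rbrakk> \<Longrightarrow>
       Ar Z V W f (p V u) = p W (compose A f u)"
    "\<And>W u. \<lbrakk>W \<in> Vect K elts; u \<in> carrier (fun_module A W)\<rbrakk> \<Longrightarrow>
       p W u = \<zero>\<^bsub>Ob Z W\<^esub> \<longleftrightarrow> (\<exists>i\<in>I. \<forall>j x. (i, j) \<in> r \<longrightarrow> x \<in> S j \<longrightarrow> u (j, x) = \<zero>\<^bsub>W\<^esub>)"
proof -
  define R where "R W = fun_module A W" for W :: "('k, 'u) module"
  define N where "N W = {u \<in> carrier (R W). \<exists>i\<in>I. \<forall>j x. (i, j) \<in> r \<longrightarrow> x \<in> S j \<longrightarrow> u (j, x) = \<zero>\<^bsub>W\<^esub>}"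
    for W :: "('k, 'u) module"
  have R_simps: "carrier (R W) = A \<rightarrow>\<^sub>E carrier W" "\<zero>\<^bsub>R W\<^esub> = (\<lambda>x\<in>A. \<zero>\<^bsub>W\<^esub>)"
    "u \<oplus>\<^bsub>R W\<^esub> v = (\<lambda>x\<in>A. u x \<oplus>\<^bsub>W\<^esub> v x)" "c \<odot>\<^bsub>R W\<^esub> u = (\<lambda>x\<in>A. c \<odot>\<^bsub>W\<^esub> u x)"
    for W u v c by (simp_all add: R_def fun_module_simps)
  have mR: "module K (R W)" if "W \<in> Vect K elts" for W
    unfolding R_def by (rule module_fun_module[OF Vect_module[OF that]])
  have inA: "(j, x) \<in> A \<longleftrightarrow> j \<in> I \<and> x \<in> S j" for j x by (auto simp: A_def)
  have rI: "j \<in> I" if "(i, j) \<in> r" for i j using directed_field[OF dir that] by simp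
  have sN: "submodule (N W) K (R W)" if W: "W \<in> Vect K elts" for W
  proof -
    interpret W: module K W by (rule Vect_module) fact
    interpret R: module K "R W" by (rule mR) fact
    show ?thesis
    proof (rule R.submoduleI')
      show "N W \<subseteq> carrier (R W)" by (auto simp: N_def)
      obtain i where "i \<in> I" using directed_nonempty[OF dir] by auto
      then show "\<zero>\<^bsub>R W\<^esub> \<in> N W"
        using R.zero_closed rI inA unfolding N_def by (auto simp: R_simps(2))
    next
      fix u v assume "u \<in> N W" "v \<in> N W"
      then obtain i j where u: "u \<in> carrier (R W)" "i \<in> I" "\<And>k x. \<lbrakk>(i, k) \<in> r; x \<in> S k\<rbrakk> \<Longrightarrow> u (k, x) = \<zero>\<^bsub>W\<^esub>"
        and v: "v \<in> carrier (R W)" "j \<in> I" "\<And>k x. \<lbrakk>(j, k) \<in> r; x \<in> S k\<rbrakk> \<Longrightarrow> v (k, x) = \<zero>\<^bsub>W\<^esub>"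
        unfolding N_def by blast
      \<comment> \<open>Past a common upper bound both families vanish, hence so does their
        sum.\<close>
      obtain l where l: "l \<in> I" "(i, l) \<in> r" "(j, l) \<in> r" using directed_bound[OF dir u(2) v(2)] by auto
      have "(u \<oplus>\<^bsub>R W\<^esub> v) (k, x) = \<zero>\<^bsub>W\<^esub>" if "(l, k) \<in> r" "x \<in> S k" for k x
      proof -
        have "(k, x) \<in> A" using that rI inA by blast
        moreover have "(i, k) \<in> r" "(j, k) \<in> r" using l that directed_trans[OF dir] by blast+
        ultimately show ?thesis using u(3)[of k x] v(3)[of k x] that by (simp add: R_simps)
      qed
      then show "u \<oplus>\<^bsub>R W\<^esub> v \<in> N W"
        using l(1) R.add.m_closed[OF u(1) v(1)] unfolding N_def by blast
    next
      fix c u assume c: "c \<in> carrier K" and "u \<in> N W"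
      then obtain i where u: "u \<in> carrier (R W)" "i \<in> I" "\<And>k x. \<lbrakk>(i, k) \<in> r; x \<in> S k\<rbrakk> \<Longrightarrow> u (k, x) = \<zero>\<^bsub>W\<^esub>"
        unfolding N_def by blast
      have "(c \<odot>\<^bsub>R W\<^esub> u) (k, x) = \<zero>\<^bsub>W\<^esub>" if "(i, k) \<in> r" "x \<in> S k" for k x
        using u(3)[OF that] that rI[OF that(1)] inA c by (simp add: R_simps)
      then show "c \<odot>\<^bsub>R W\<^esub> u \<in> N W"
        using u(2) R.smult_closed[OF c u(1)] unfolding N_def by blast
    qed
  qed
  have "\<forall>W\<in>Vect K elts. \<exists>Q p. Q \<in> Vect K elts \<and> p \<in> hom_sp K (R W) Q \<and> p ` carrier (R W) = carrier Q \<and>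
      (\<forall>u\<in>carrier (R W). p u = \<zero>\<^bsub>Q\<^esub> \<longleftrightarrow> u \<in> N W)"
  proof
    fix W assume W: "W \<in> Vect K elts"
    have "encodable elts (carrier (R W))"
      unfolding R_simps A_def
      by (intro encodable_PiE encodable_Sigma I S encodable_small[OF Vect_small[OF W]])
    from small_quotient[OF mR[OF W] sN[OF W] this]
    show "\<exists>Q p. Q \<in> Vect K elts \<and> p \<in> hom_sp K (R W) Q \<and> p ` carrier (R W) = carrier Q \<and>
      (\<forall>u\<in>carrier (R W). p u = \<zero>\<^bsub>Q\<^esub> \<longleftrightarrow> u \<in> N W)" by metis
  qed
  \<comment> \<open>The encoded quotients are only known to exist, so a value \<open>Q W\<close> and
    a projection \<open>p W\<close> are chosen for each \<open>W\<close>.\<close>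
  then obtain Q p where Qp: "\<forall>W\<in>Vect K elts. Q W \<in> Vect K elts \<and> p W \<in> hom_sp K (R W) (Q W) \<and>
      p W ` carrier (R W) = carrier (Q W) \<and> (\<forall>u\<in>carrier (R W). p W u = \<zero>\<^bsub>Q W\<^esub> \<longleftrightarrow> u \<in> N W)"
    by metis
  have Q: "Q W \<in> Vect K elts" and p: "p W \<in> hom_sp K (R W) (Q W)"
    and surj: "carrier (Q W) = p W ` carrier (R W)"
    and ker: "\<And>u. u \<in> carrier (R W) \<Longrightarrow> p W u = \<zero>\<^bsub>Q W\<^esub> \<longleftrightarrow> u \<in> N W"
    if "W \<in> Vect K elts" for W
    using Qp that by blast+
  define Z :: "('k, 'u, 'u) vfunctor" where
    "Z = \<lparr>Ob = Q, Ar = (\<lambda>V W f. \<lambda>q\<in>carrier (Q V). p W (compose A f (inv_into (carrier (R V)) (p V) q)))\<rparr>"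
  have comp: "compose A f u \<in> carrier (R W)" if "f \<in> hom_sp K V W" "u \<in> carrier (R V)" for f u V W
    using that hom_sp_closed[OF that(1)] by (auto simp: R_simps compose_def PiE_iff)
  have comp_minus: "compose A f (u \<ominus>\<^bsub>R V\<^esub> v) = compose A f u \<ominus>\<^bsub>R W\<^esub> compose A f v"
    if V: "V \<in> Vect K elts" and W: "W \<in> Vect K elts" and f: "f \<in> hom_sp K V W"
      and u: "u \<in> carrier (R V)" "v \<in> carrier (R V)" for V W f u v
  proof -
    have "(\<lambda>u\<in>carrier (R V). compose A f u) \<in> hom_sp K (R V) (R W)"
    proof -
      interpret RV: module K "R V" by (rule mR) fact
      show ?thesis
      proof (rule hom_spI)
        fix u v assume "u \<in> carrier (R V)" "v \<in> carrier (R V)"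
        then show "(\<lambda>u\<in>carrier (R V). compose A f u) (u \<oplus>\<^bsub>R V\<^esub> v) =
          (\<lambda>u\<in>carrier (R V). compose A f u) u \<oplus>\<^bsub>R W\<^esub> (\<lambda>u\<in>carrier (R V). compose A f u) v"
          using RV.add.m_closed[of u v]
          by (auto simp: R_simps compose_def PiE_iff hom_sp_add[OF f] intro!: restrict_ext)
      next
        fix c u assume "c \<in> carrier K" "u \<in> carrier (R V)"
        then show "(\<lambda>u\<in>carrier (R V). compose A f u) (c \<odot>\<^bsub>R V\<^esub> u) =
          c \<odot>\<^bsub>R W\<^esub> (\<lambda>u\<in>carrier (R V). compose A f u) u"
          using RV.smult_closed[of c u]
          by (auto simp: R_simps compose_def PiE_iff hom_sp_smult[OF f] intro!: restrict_ext)
      qed (use comp[OF f] in auto)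
    qed
    from hom_sp_minus[OF mR[OF V] mR[OF W] this u] show ?thesis
      using u abelian_group.minus_closed[OF module.axioms(2)[OF mR[OF V]] u] by simp
  qed
  have p_eq: "p W u = p W v \<longleftrightarrow> u \<ominus>\<^bsub>R W\<^esub> v \<in> N W"
    if W: "W \<in> Vect K elts" and u: "u \<in> carrier (R W)" "v \<in> carrier (R W)" for W u v
  proof -
    interpret R: module K "R W" by (rule mR) fact
    interpret Q: module K "Q W" by (rule Vect_module[OF Q]) fact
    have "u \<ominus>\<^bsub>R W\<^esub> v \<in> N W \<longleftrightarrow> p W u \<ominus>\<^bsub>Q W\<^esub> p W v = \<zero>\<^bsub>Q W\<^esub>"
      using ker[OF W, of "u \<ominus>\<^bsub>R W\<^esub> v"] hom_sp_minus[OF R.module_axioms Q.module_axioms p[OF W] u] u by simp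
    then show ?thesis using hom_sp_closed[OF p[OF W]] u by (simp add: Q.minus_eq_zero_iff)
  qed
  have Ar: "Ar Z V W f (p V u) = p W (compose A f u)"
    if V: "V \<in> Vect K elts" and W: "W \<in> Vect K elts" and f: "f \<in> hom_sp K V W" and u: "u \<in> carrier (R V)"
    for V W f u
  proof -
    \<comment> \<open>\<open>?v\<close> is the representative that \<open>Z\<close> picks. It
      differs from \<open>u\<close> by an eventually zero family, and \<open>f\<close> sends such
      families to eventually zero ones, so the resulting class is that of \<open>u\<close> composed
      with \<open>f\<close>.\<close>
    let ?v = "inv_into (carrier (R V)) (p V) (p V u)"
    have v: "?v \<in> carrier (R V)" "p V ?v = p V u" using u by (auto simp: inv_into_into f_inv_into_f)
    have "?v \<ominus>\<^bsub>R V\<^esub> u \<in> N V" using p_eq[OF V v(1) u] v(2) by simp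
    then obtain i where i: "i \<in> I" "\<And>j x. \<lbrakk>(i, j) \<in> r; x \<in> S j\<rbrakk> \<Longrightarrow> (?v \<ominus>\<^bsub>R V\<^esub> u) (j, x) = \<zero>\<^bsub>V\<^esub>"
      and vu: "?v \<ominus>\<^bsub>R V\<^esub> u \<in> carrier (R V)"
      unfolding N_def by blast
    have "compose A f (?v \<ominus>\<^bsub>R V\<^esub> u) (j, x) = \<zero>\<^bsub>W\<^esub>" if "(i, j) \<in> r" "x \<in> S j" for j x
      using i(2)[OF that] that rI[OF that(1)] hom_sp_zero[OF Vect_module[OF V] Vect_module[OF W] f]
      by (simp add: compose_def inA)
    then have "compose A f (?v \<ominus>\<^bsub>R V\<^esub> u) \<in> N W"
      using i(1) comp[OF f vu] unfolding N_def by blast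
    then have "p W (compose A f ?v) = p W (compose A f u)"
      using comp_minus[OF V W f v(1) u] p_eq[OF W comp[OF f v(1)] comp[OF f u]] by simp
    then show ?thesis using u by (simp add: Z_def surj[OF V])
  qed
  have Ob: "Ob Z = Q" by (simp add: Z_def)
  have p_add: "p W (u \<oplus>\<^bsub>R W\<^esub> v) = p W u \<oplus>\<^bsub>Q W\<^esub> p W v"
    if "W \<in> Vect K elts" "u \<in> carrier (R W)" "v \<in> carrier (R W)" for W u v
    using hom_sp_add[OF p] that by blast
  have p_smult: "p W (c \<odot>\<^bsub>R W\<^esub> u) = c \<odot>\<^bsub>Q W\<^esub> p W u"
    if "W \<in> Vect K elts" "u \<in> carrier (R W)" "c \<in> carrier K" for W u c
    using hom_sp_smult[OF p] that by blast
  have "Z \<in> Functors K elts"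
    unfolding Functors_def mem_Collect_eq Ob
  proof (intro conjI ballI)
    fix V W assume V: "V \<in> Vect K elts" and W: "W \<in> Vect K elts"
    interpret V: module K V by (rule Vect_module) fact
    interpret W: module K W by (rule Vect_module) fact
    interpret RV: module K "R V" by (rule mR) fact
    interpret RW: module K "R W" by (rule mR) fact
    interpret QW: module K "Q W" by (rule Vect_module[OF Q]) fact
    interpret QV: module K "Q V" by (rule Vect_module[OF Q]) fact
    interpret H: module K "Hom K V W" by (intro module_Hom V.module_axioms W.module_axioms)
    have ArI: "Ar Z V W f \<in> hom_sp K (Q V) (Q W)" if f: "f \<in> hom_sp K V W" for f
    proof (rule hom_spI)
      show "Ar Z V W f \<in> extensional (carrier (Q V))" by (simp add: Z_def)
      fix a assume "a \<in> carrier (Q V)"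
      then obtain u where u: "u \<in> carrier (R V)" "a = p V u" by (auto simp: surj[OF V])
      then show "Ar Z V W f a \<in> carrier (Q W)"
        using comp[OF f u(1)] by (simp add: Ar[OF V W f] surj[OF W])
      {
        fix b assume "b \<in> carrier (Q V)"
        then obtain v where v: "v \<in> carrier (R V)" "b = p V v" by (auto simp: surj[OF V])
        have uv: "u \<oplus>\<^bsub>R V\<^esub> v \<in> carrier (R V)" using u(1) v(1) by simp
        have "compose A f (u \<oplus>\<^bsub>R V\<^esub> v) = compose A f u \<oplus>\<^bsub>R W\<^esub> compose A f v"
          using u(1) v(1) by (auto simp: R_simps compose_def PiE_iff hom_sp_add[OF f] intro!: restrict_ext)
        then show "Ar Z V W f (a \<oplus>\<^bsub>Q V\<^esub> b) = Ar Z V W f a \<oplus>\<^bsub>Q W\<^esub> Ar Z V W f b"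
          using Ar[OF V W f uv] Ar[OF V W f u(1)] Ar[OF V W f v(1)] p_add[OF V u(1) v(1)]
            p_add[OF W comp[OF f u(1)] comp[OF f v(1)]] u(2) v(2) by simp
      next
        fix c assume c: "c \<in> carrier K"
        have cu: "c \<odot>\<^bsub>R V\<^esub> u \<in> carrier (R V)" using u(1) c by simp
        have "compose A f (c \<odot>\<^bsub>R V\<^esub> u) = c \<odot>\<^bsub>R W\<^esub> compose A f u"
          using u(1) c by (auto simp: R_simps compose_def PiE_iff hom_sp_smult[OF f] intro!: restrict_ext)
        then show "Ar Z V W f (c \<odot>\<^bsub>Q V\<^esub> a) = c \<odot>\<^bsub>Q W\<^esub> Ar Z V W f a"
          using Ar[OF V W f cu] Ar[OF V W f u(1)] p_smult[OF V u(1) c] p_smult[OF W comp[OF f u(1)] c] u(2)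
          by simp
      }
    qed
    show "restrict (Ar Z V W) (hom_sp K V W) \<in> hom_sp K (Hom K V W) (Hom K (Q V) (Q W))"
    proof (rule hom_spI)
      show "restrict (Ar Z V W) (hom_sp K V W) \<in> extensional (carrier (Hom K V W))" by simp
      fix f assume "f \<in> carrier (Hom K V W)"
      then have f: "f \<in> hom_sp K V W" by simp
      then show "restrict (Ar Z V W) (hom_sp K V W) f \<in> carrier (Hom K (Q V) (Q W))"
        using ArI by simp
      {
        fix g assume "g \<in> carrier (Hom K V W)"
        then have g: "g \<in> hom_sp K V W" by simp
        have fg: "f \<oplus>\<^bsub>Hom K V W\<^esub> g \<in> hom_sp K V W" using H.add.m_closed[of f g] f g by simp
        have "Ar Z V W (f \<oplus>\<^bsub>Hom K V W\<^esub> g) = Ar Z V W f \<oplus>\<^bsub>Hom K (Q V) (Q W)\<^esub> Ar Z V W g"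
        proof (rule extensionalityI[of _ "carrier (Q V)"])
          show "Ar Z V W (f \<oplus>\<^bsub>Hom K V W\<^esub> g) \<in> extensional (carrier (Q V))" by (rule hom_sp_ext[OF ArI[OF fg]])
          show "Ar Z V W f \<oplus>\<^bsub>Hom K (Q V) (Q W)\<^esub> Ar Z V W g \<in> extensional (carrier (Q V))" by simp
          fix a assume a: "a \<in> carrier (Q V)"
          then obtain u where u: "u \<in> carrier (R V)" "a = p V u" by (auto simp: surj[OF V])
          have "compose A (f \<oplus>\<^bsub>Hom K V W\<^esub> g) u = compose A f u \<oplus>\<^bsub>R W\<^esub> compose A g u"
            using u(1) by (auto simp: R_simps compose_def PiE_iff intro!: restrict_ext)
          then show "Ar Z V W (f \<oplus>\<^bsub>Hom K V W\<^esub> g) a = (Ar Z V W f \<oplus>\<^bsub>Hom K (Q V) (Q W)\<^esub> Ar Z V W g) a"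
            using Ar[OF V W fg u(1)] Ar[OF V W f u(1)] Ar[OF V W g u(1)]
              p_add[OF W comp[OF f u(1)] comp[OF g u(1)]] u(2) a by simp
        qed
        then show "restrict (Ar Z V W) (hom_sp K V W) (f \<oplus>\<^bsub>Hom K V W\<^esub> g) =
          restrict (Ar Z V W) (hom_sp K V W) f \<oplus>\<^bsub>Hom K (Q V) (Q W)\<^esub> restrict (Ar Z V W) (hom_sp K V W) g"
          using f g fg by (simp del: Hom_simps)
      next
        fix c assume c: "c \<in> carrier K"
        have cf: "c \<odot>\<^bsub>Hom K V W\<^esub> f \<in> hom_sp K V W" using H.smult_closed[of c f] f c by simp
        have "Ar Z V W (c \<odot>\<^bsub>Hom K V W\<^esub> f) = c \<odot>\<^bsub>Hom K (Q V) (Q W)\<^esub> Ar Z V W f"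
        proof (rule extensionalityI[of _ "carrier (Q V)"])
          show "Ar Z V W (c \<odot>\<^bsub>Hom K V W\<^esub> f) \<in> extensional (carrier (Q V))" by (rule hom_sp_ext[OF ArI[OF cf]])
          show "c \<odot>\<^bsub>Hom K (Q V) (Q W)\<^esub> Ar Z V W f \<in> extensional (carrier (Q V))" by simp
          fix a assume a: "a \<in> carrier (Q V)"
          then obtain u where u: "u \<in> carrier (R V)" "a = p V u" by (auto simp: surj[OF V])
          have "compose A (c \<odot>\<^bsub>Hom K V W\<^esub> f) u = c \<odot>\<^bsub>R W\<^esub> compose A f u"
            using u(1) by (auto simp: R_simps compose_def PiE_iff intro!: restrict_ext)
          then show "Ar Z V W (c \<odot>\<^bsub>Hom K V W\<^esub> f) a = (c \<odot>\<^bsub>Hom K (Q V) (Q W)\<^esub> Ar Z V W f) a"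
            using Ar[OF V W cf u(1)] Ar[OF V W f u(1)] p_smult[OF W comp[OF f u(1)] c] u(2) a by simp
        qed
        then show "restrict (Ar Z V W) (hom_sp K V W) (c \<odot>\<^bsub>Hom K V W\<^esub> f) =
          c \<odot>\<^bsub>Hom K (Q V) (Q W)\<^esub> restrict (Ar Z V W) (hom_sp K V W) f"
          using f cf by (simp del: Hom_simps)
      }
    qed
  next
    fix V assume V: "V \<in> Vect K elts"
    show "Ar Z V V (\<lambda>x\<in>carrier V. x) = (\<lambda>x\<in>carrier (Q V). x)"
    proof (rule extensionalityI[of _ "carrier (Q V)"])
      fix a assume a: "a \<in> carrier (Q V)"
      then obtain u where u: "u \<in> carrier (R V)" "a = p V u" by (auto simp: surj[OF V])
      have "compose A (\<lambda>x\<in>carrier V. x) u = u"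
        using u(1) by (auto simp: R_simps compose_def PiE_iff intro!: extensionalityI[of _ A])
      then show "Ar Z V V (\<lambda>x\<in>carrier V. x) a = (\<lambda>x\<in>carrier (Q V). x) a"
        using Ar[OF V V hom_sp_id[OF Vect_module[OF V]] u(1)] u(2) a by simp
    qed (simp_all add: Z_def)
  next
    fix U V W f g assume U: "U \<in> Vect K elts" and V: "V \<in> Vect K elts" and W: "W \<in> Vect K elts"
      and f: "f \<in> hom_sp K U V" and g: "g \<in> hom_sp K V W"
    have gf: "compose (carrier U) g f \<in> hom_sp K U W" by (rule hom_sp_compose[OF Vect_module[OF U] f g])
    show "Ar Z U W (compose (carrier U) g f) = compose (carrier (Q U)) (Ar Z V W g) (Ar Z U V f)"
    proof (rule extensionalityI[of _ "carrier (Q U)"])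
      fix a assume a: "a \<in> carrier (Q U)"
      then obtain u where u: "u \<in> carrier (R U)" "a = p U u" by (auto simp: surj[OF U])
      have "compose A (compose (carrier U) g f) u = compose A g (compose A f u)"
        using u(1) by (auto simp: R_simps compose_def PiE_iff intro!: restrict_ext)
      then show "Ar Z U W (compose (carrier U) g f) a = compose (carrier (Q U)) (Ar Z V W g) (Ar Z U V f) a"
        using Ar[OF U W gf u(1)] Ar[OF U V f u(1)] Ar[OF V W g comp[OF f u(1)]] u(2) a
        by (simp add: compose_eq)
    qed (simp_all add: Z_def)
  qed (rule Q)
  moreover have "p W \<in> hom_sp K (fun_module A W) (Ob Z W)" if "W \<in> Vect K elts" for W
    using p[OF that] by (simp add: R_def Ob)
  moreover have "Ar Z V W f (p V u) = p W (compose A f u)"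
    if "V \<in> Vect K elts" "W \<in> Vect K elts" "f \<in> hom_sp K V W" "u \<in> carrier (fun_module A V)" for V W f u
    using Ar that by (simp add: R_def)
  moreover have "p W u = \<zero>\<^bsub>Ob Z W\<^esub> \<longleftrightarrow> (\<exists>i\<in>I. \<forall>j x. (i, j) \<in> r \<longrightarrow> x \<in> S j \<longrightarrow> u (j, x) = \<zero>\<^bsub>W\<^esub>)"
    if "W \<in> Vect K elts" "u \<in> carrier (fun_module A W)" for W u
    using ker[OF that(1), of u] that(2) by (simp add: R_def Ob N_def)
  ultimately show ?thesis by (rule that)
qed

end

lemma is_colimitD:
  assumes "is_colimit K elts I r F \<phi> X \<kappa>"
  shows colimit_cocone: "is_cocone K elts I r F \<phi> X \<kappa>"
    and colimit_ex1: "is_cocone K elts I r F \<phi> Z \<mu> \<Longrightarrow> \<exists>!\<eta>. \<eta> \<in> Nat K elts X Z \<and>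
      (\<forall>i\<in>I. \<forall>V\<in>Vect K elts. \<forall>g\<in>hom_sp K (F i) V. \<eta> V (\<kappa> i V g) = \<mu> i V g)"
proof -
  note * = assms[unfolded is_colimit_def]
  show "is_cocone K elts I r F \<phi> X \<kappa>" by (rule *[THEN conjunct1])
  show "is_cocone K elts I r F \<phi> Z \<mu> \<Longrightarrow> \<exists>!\<eta>. \<eta> \<in> Nat K elts X Z \<and>
      (\<forall>i\<in>I. \<forall>V\<in>Vect K elts. \<forall>g\<in>hom_sp K (F i) V. \<eta> V (\<kappa> i V g) = \<mu> i V g)"
    by (rule *[THEN conjunct2, THEN spec[of _ Z], THEN spec[of _ \<mu>], THEN mp])
qed

text \<open>A map \<open>g\<close> at index \<open>i\<close> is sent to the class of the family with
  entry \<open>g (\<phi> i j x)\<close> at \<open>(j, x)\<close>. These assignments form a cocone,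
  so they factor through \<open>X\<close>; if \<open>\<kappa> i V g\<close> is zero, so is the
  class, and the family vanishes from some index on.\<close>

lemma (in universe) colimit_leg_eq_zeroD:
  fixes K :: "('k, 'm) ring_scheme" and I :: "'i set"
  assumes dir: "directed_poset I r" and dia: "op_diagram K elts I r F \<phi>"
    and col: "is_colimit K elts I r F \<phi> X \<kappa>" and enc: "encodable elts I"
    and i: "i \<in> I" and V: "V \<in> Vect K elts" and g: "g \<in> hom_sp K (F i) V"
    and zero: "\<kappa> i V g = \<zero>\<^bsub>Ob X V\<^esub>"
  shows "\<exists>j. (i, j) \<in> r \<and> (\<forall>x\<in>carrier (F j). g (\<phi> i j x) = \<zero>\<^bsub>V\<^esub>)"
proof -
  note FV = op_diagram_Ob[OF dia]
  note rI = directed_field[OF dir]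
  define A where "A = Sigma I (\<lambda>i. carrier (F i))"
  have small_F: "small elts (carrier (F i))" if "i \<in> I" for i
    by (rule Vect_small[OF FV[OF that]])
  obtain Z :: "('k, 'u, 'u) vfunctor" and p where
    Z: "Z \<in> Functors K elts"
    and p: "\<And>W. W \<in> Vect K elts \<Longrightarrow> p W \<in> hom_sp K (fun_module A W) (Ob Z W)"
    and ArZ: "\<And>V W f u. \<lbrakk>V \<in> Vect K elts; W \<in> Vect K elts; f \<in> hom_sp K V W; u \<in> carrier (fun_module A V)\<rbrakk> \<Longrightarrow>
       Ar Z V W f (p V u) = p W (compose A f u)"
    and ker: "\<And>W u. \<lbrakk>W \<in> Vect K elts; u \<in> carrier (fun_module A W)\<rbrakk> \<Longrightarrow>
       p W u = \<zero>\<^bsub>Ob Z W\<^esub> \<longleftrightarrow> (\<exists>i\<in>I. \<forall>j x. (i, j) \<in> r \<longrightarrow> x \<in> carrier (F j) \<longrightarrow> u (j, x) = \<zero>\<^bsub>W\<^esub>)"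
  proof (rule reduced_power_functor[where K = K and S = "\<lambda>i. carrier (F i)", OF dir enc], goal_cases)
    case (1 i)
    show ?case by (rule small_F[OF 1(2)])
  next
    case (2 Z p)
    show ?case by (rule 2(1)[OF 2(2) 2(3-5)[folded A_def]])
  qed
  \<comment> \<open>All points \<open>x\<close> of all \<open>F j\<close> occur as coordinates, so
    for \<open>j\<close> above \<open>i\<close> vanishing at index \<open>j\<close> means that
    \<open>g\<close> after \<open>\<phi> i j\<close> is zero. The default zero at indices not above
    \<open>i\<close> does not affect the class, which is determined by the entries at indices above
    \<open>i\<close>.\<close>
  define e where "e i W g = (\<lambda>a\<in>A. if (i, fst a) \<in> r then g (\<phi> i (fst a) (snd a)) else \<zero>\<^bsub>W\<^esub>)"
    for i and W :: "('k, 'u) module" and g :: "'u \<Rightarrow> 'u"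
  have \<phi>: "\<phi> i j x \<in> carrier (F i)" if "(i, j) \<in> r" "x \<in> carrier (F j)" for i j x
    by (rule hom_sp_closed[OF op_diagram_hom[OF dia that(1)] that(2)])
  have e: "e i W g \<in> carrier (fun_module A W)" if W: "W \<in> Vect K elts" and g: "g \<in> hom_sp K (F i) W" for i W g
  proof -
    interpret W: module K W by (rule Vect_module) fact
    show ?thesis
      using hom_sp_closed[OF g] \<phi> by (auto simp: e_def A_def fun_module_simps)
  qed
  define \<mu> where "\<mu> i = (\<lambda>W\<in>Vect K elts. \<lambda>g\<in>hom_sp K (F i) W. p W (e i W g))" for i
  have \<mu>: "\<mu> i W g = p W (e i W g)" if "W \<in> Vect K elts" "g \<in> hom_sp K (F i) W" for i W g
    using that by (simp add: \<mu>_def)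
  have "is_cocone K elts I r F \<phi> Z \<mu>"
    unfolding is_cocone_def
  proof (intro conjI ballI Z)
    fix i assume i: "i \<in> I"
    note Fi = Vect_module[OF FV[OF i]]
    show "\<mu> i \<in> Nat K elts (Yo K (F i)) Z"
      unfolding Nat_def mem_Collect_eq
    proof (intro conjI PiE_I ballI)
      fix W assume W: "W \<in> Vect K elts"
      interpret W: module K W by (rule Vect_module) fact
      interpret H: module K "Hom K (F i) W" by (rule module_Hom[OF Fi W.module_axioms])
      show "\<mu> i W \<in> hom_sp K (Ob (Yo K (F i)) W) (Ob Z W)"
      proof (rule hom_spI)
        show "\<mu> i W \<in> extensional (carrier (Ob (Yo K (F i)) W))" using W by (simp add: \<mu>_def)
        fix g assume "g \<in> carrier (Ob (Yo K (F i)) W)"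
        then have g: "g \<in> hom_sp K (F i) W" by simp
        show "\<mu> i W g \<in> carrier (Ob Z W)"
          unfolding \<mu>[OF W g] by (rule hom_sp_closed[OF p[OF W] e[OF W g]])
        {
          fix h assume "h \<in> carrier (Ob (Yo K (F i)) W)"
          then have h: "h \<in> hom_sp K (F i) W" by simp
          have gh: "g \<oplus>\<^bsub>Hom K (F i) W\<^esub> h \<in> hom_sp K (F i) W" using H.add.m_closed[of g h] g h by simp
          have "e i W (g \<oplus>\<^bsub>Hom K (F i) W\<^esub> h) = e i W g \<oplus>\<^bsub>fun_module A W\<^esub> e i W h"
            using \<phi> by (auto simp: e_def fun_module_simps A_def intro!: restrict_ext)
          then show "\<mu> i W (g \<oplus>\<^bsub>Ob (Yo K (F i)) W\<^esub> h) = \<mu> i W g \<oplus>\<^bsub>Ob Z W\<^esub> \<mu> i W h"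
            using hom_sp_add[OF p[OF W] e[OF W g] e[OF W h]]
            by (simp add: \<mu>[OF W g] \<mu>[OF W h] \<mu>[OF W gh] del: Hom_simps)
        next
          fix c assume c: "c \<in> carrier K"
          have cg: "c \<odot>\<^bsub>Hom K (F i) W\<^esub> g \<in> hom_sp K (F i) W" using H.smult_closed[of c g] g c by simp
          have "e i W (c \<odot>\<^bsub>Hom K (F i) W\<^esub> g) = c \<odot>\<^bsub>fun_module A W\<^esub> e i W g"
            using \<phi> c by (auto simp: e_def fun_module_simps A_def intro!: restrict_ext)
          then show "\<mu> i W (c \<odot>\<^bsub>Ob (Yo K (F i)) W\<^esub> g) = c \<odot>\<^bsub>Ob Z W\<^esub> \<mu> i W g"
            using hom_sp_smult[OF p[OF W] c e[OF W g]]
            by (simp add: \<mu>[OF W g] \<mu>[OF W cg] del: Hom_simps)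
        }
      qed
      fix W' f g assume W': "W' \<in> Vect K elts" and f: "f \<in> hom_sp K W W'"
        and "g \<in> carrier (Ob (Yo K (F i)) W)"
      then have g: "g \<in> hom_sp K (F i) W" by simp
      have fg: "compose (carrier (F i)) f g \<in> hom_sp K (F i) W'" by (rule hom_sp_compose[OF Fi g f])
      have "compose A f (e i W g) = e i W' (compose (carrier (F i)) f g)"
        using \<phi> hom_sp_zero[OF Vect_module[OF W] Vect_module[OF W'] f]
        by (auto simp: e_def compose_def A_def intro!: restrict_ext)
      then show "\<mu> i W' (Ar (Yo K (F i)) W W' f g) = Ar Z W W' f (\<mu> i W g)"
        using ArZ[OF W W' f e[OF W g]] g by (simp add: \<mu>[OF W g] \<mu>[OF W' fg])
    qed (simp add: \<mu>_def)
  next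
    fix ij assume "ij \<in> r"
    then obtain i j where ij: "ij = (i, j)" "(i, j) \<in> r" by (cases ij) auto
    have "\<mu> j V (compose (carrier (F j)) g (\<phi> i j)) = \<mu> i V g"
      if V: "V \<in> Vect K elts" and g: "g \<in> hom_sp K (F i) V" for V g
    proof -
      have Fj: "F j \<in> Vect K elts" using FV rI ij(2) by blast
      interpret V: module K V by (rule Vect_module) fact
      interpret R: module K "fun_module A V" by (rule module_fun_module) (rule V.module_axioms)
      interpret ZV: module K "Ob Z V" by (rule Vect_module[OF Functors_Ob[OF Z V]])
      let ?h = "compose (carrier (F j)) g (\<phi> i j)"
      have h: "?h \<in> hom_sp K (F j) V"
        by (rule hom_sp_compose[OF Vect_module[OF Fj] op_diagram_hom[OF dia ij(2)] g])
      \<comment> \<open>Above \<open>j\<close> the two families coincide because the diagram is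
        functorial; they may differ elsewhere, but their classes are equal.\<close>
      have eq: "e j V ?h (k, x) = e i V g (k, x)" if k: "(j, k) \<in> r" "x \<in> carrier (F k)" for k x
        using k rI[OF k(1)] directed_trans[OF dir ij(2) k(1)] \<phi>[OF k] op_diagram_comp[OF dia ij(2) k]
        by (simp add: e_def A_def compose_eq)
      have "(e j V ?h \<ominus>\<^bsub>fun_module A V\<^esub> e i V g) (k, x) = \<zero>\<^bsub>V\<^esub>" if k: "(j, k) \<in> r" "x \<in> carrier (F k)" for k x
      proof -
        have kA: "(k, x) \<in> A" using k rI by (auto simp: A_def)
        have "(e j V ?h \<ominus>\<^bsub>fun_module A V\<^esub> e i V g) \<oplus>\<^bsub>fun_module A V\<^esub> e i V g = e j V ?h"
          using e[OF V h] e[OF V g] by (simp add: a_minus_def R.a_assoc R.l_neg)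
        from fun_cong[OF this, of "(k, x)"]
        have "(e j V ?h \<ominus>\<^bsub>fun_module A V\<^esub> e i V g) (k, x) \<oplus>\<^bsub>V\<^esub> e i V g (k, x) = e i V g (k, x)"
          using kA eq[OF k] by (simp add: fun_module_simps)
        moreover have "(e j V ?h \<ominus>\<^bsub>fun_module A V\<^esub> e i V g) (k, x) \<in> carrier V" "e i V g (k, x) \<in> carrier V"
          using R.minus_closed[OF e[OF V h] e[OF V g]] e[OF V g] kA by (auto simp: fun_module_simps)
        ultimately show ?thesis by simp
      qed
      then have "p V (e j V ?h \<ominus>\<^bsub>fun_module A V\<^esub> e i V g) = \<zero>\<^bsub>Ob Z V\<^esub>"
        using ker[OF V R.minus_closed[OF e[OF V h] e[OF V g]]] rI[OF ij(2)] by blast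
      then have "p V (e j V ?h) = p V (e i V g)"
        using hom_sp_minus[OF R.module_axioms ZV.module_axioms p[OF V] e[OF V h] e[OF V g]]
          hom_sp_closed[OF p[OF V] e[OF V h]] hom_sp_closed[OF p[OF V] e[OF V g]]
        by (simp add: ZV.minus_eq_zero_iff)
      then show ?thesis by (simp add: \<mu>[OF V g] \<mu>[OF V h])
    qed
    then show "case ij of (i, j) \<Rightarrow> \<forall>V\<in>Vect K elts. \<forall>g\<in>hom_sp K (F i) V.
        \<mu> j V (compose (carrier (F j)) g (\<phi> i j)) = \<mu> i V g"
      by (simp add: ij(1))
  qed
  from colimit_ex1[OF col this]
  obtain \<eta> where \<eta>: "\<eta> \<in> Nat K elts X Z"
    "\<forall>i\<in>I. \<forall>V\<in>Vect K elts. \<forall>g\<in>hom_sp K (F i) V. \<eta> V (\<kappa> i V g) = \<mu> i V g" by blast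
  have X: "X \<in> Functors K elts" by (rule cocone_functor[OF colimit_cocone[OF col]])
  have "p V (e i V g) = \<eta> V (\<kappa> i V g)" using \<eta>(2) i V g \<mu>[OF V g] by simp
  also have "\<dots> = \<zero>\<^bsub>Ob Z V\<^esub>"
    unfolding zero by (rule hom_sp_zero[OF Vect_module[OF Functors_Ob[OF X V]]
      Vect_module[OF Functors_Ob[OF Z V]] Nat_hom[OF \<eta>(1) V]])
  finally obtain j where j: "j \<in> I" "\<And>k x. \<lbrakk>(j, k) \<in> r; x \<in> carrier (F k)\<rbrakk> \<Longrightarrow> e i V g (k, x) = \<zero>\<^bsub>V\<^esub>"
    using ker[OF V e[OF V g]] by blast
  \<comment> \<open>The family vanishes past \<open>j\<close>, which need not lie above
    \<open>i\<close>; at a common upper bound \<open>k\<close> its entries are genuine values of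
    \<open>g\<close> after \<open>\<phi> i k\<close>.\<close>
  obtain k where k: "k \<in> I" "(i, k) \<in> r" "(j, k) \<in> r" using directed_bound[OF dir i j(1)] by blast
  have "g (\<phi> i k x) = \<zero>\<^bsub>V\<^esub>" if "x \<in> carrier (F k)" for x
    using j(2)[OF k(3) that] k that by (simp add: e_def A_def)
  then show ?thesis using k(2) by blast
qed

text \<open>
  The elements coming from the legs form a subfunctor \<open>Z\<close> of \<open>X\<close> that receives the cocone; the
  composite \<open>X \<rightarrow> Z \<subseteq> X\<close> is the identity by uniqueness.
\<close>

lemma (in universe) colimit_legs_surj:
  assumes dir: "directed_poset I r" and dia: "op_diagram K elts I r F \<phi>"
    and col: "is_colimit K elts I r F \<phi> X \<kappa>"
    and V: "V \<in> Vect K elts" and x: "x \<in> carrier (Ob X V)"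
  obtains i g where "i \<in> I" "g \<in> hom_sp K (F i) V" "x = \<kappa> i V g"
proof -
  note coc = colimit_cocone[OF col]
  note X = cocone_functor[OF coc]
  note FV = op_diagram_Ob[OF dia]
  note rI = directed_field[OF dir]
  define S where "S W = {\<kappa> i W g |i g. i \<in> I \<and> g \<in> hom_sp K (F i) W}" for W
  have mX: "module K (Ob X W)" if "W \<in> Vect K elts" for W
    by (rule Vect_module[OF Functors_Ob[OF X that]])
  have sub: "S W \<subseteq> carrier (Ob X W)" if "W \<in> Vect K elts" for W
    using cocone_closed[OF coc _ that] by (auto simp: S_def)
  have mH: "module K (Hom K (F i) W)" if "i \<in> I" "W \<in> Vect K elts" for i W
    by (rule module_Hom[OF Vect_module[OF FV[OF that(1)]] Vect_module[OF that(2)]])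
  have sS: "submodule (S W) K (Ob X W)" if W: "W \<in> Vect K elts" for W
  proof (rule module.submoduleI'[OF mX[OF W] sub[OF W]])
    obtain i where i: "i \<in> I" using directed_nonempty[OF dir] by blast
    interpret H: module K "Hom K (F i) W" by (rule mH) fact+
    have "\<kappa> i W \<zero>\<^bsub>Hom K (F i) W\<^esub> = \<zero>\<^bsub>Ob X W\<^esub>"
      by (rule hom_sp_zero[OF H.module_axioms mX[OF W] cocone_hom[OF coc i W]])
    moreover have "\<zero>\<^bsub>Hom K (F i) W\<^esub> \<in> hom_sp K (F i) W" using H.zero_closed by simp
    ultimately show "\<zero>\<^bsub>Ob X W\<^esub> \<in> S W" using i unfolding S_def by (metis (mono_tags, lifting) mem_Collect_eq)
  next
    fix a b assume "a \<in> S W" "b \<in> S W"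
    then obtain i j g h where a: "i \<in> I" "g \<in> hom_sp K (F i) W" "a = \<kappa> i W g"
      and b: "j \<in> I" "h \<in> hom_sp K (F j) W" "b = \<kappa> j W h" by (auto simp: S_def)
    \<comment> \<open>To add elements of two legs, both are rewritten as elements of the leg at a
      common upper bound.\<close>
    obtain k where k: "k \<in> I" "(i, k) \<in> r" "(j, k) \<in> r" using directed_bound[OF dir a(1) b(1)] by blast
    interpret H: module K "Hom K (F k) W" by (rule mH) fact+
    note Fk = Vect_module[OF FV[OF k(1)]]
    let ?g = "compose (carrier (F k)) g (\<phi> i k)" and ?h = "compose (carrier (F k)) h (\<phi> j k)"
    have g: "?g \<in> hom_sp K (F k) W" by (rule hom_sp_compose[OF Fk op_diagram_hom[OF dia k(2)] a(2)])
    have h: "?h \<in> hom_sp K (F k) W" by (rule hom_sp_compose[OF Fk op_diagram_hom[OF dia k(3)] b(2)])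
    have "a = \<kappa> k W ?g" "b = \<kappa> k W ?h"
      using cocone_comp[OF coc k(2) W a(2)] cocone_comp[OF coc k(3) W b(2)] a b by simp_all
    then have "a \<oplus>\<^bsub>Ob X W\<^esub> b = \<kappa> k W (?g \<oplus>\<^bsub>Hom K (F k) W\<^esub> ?h)"
      using hom_sp_add[OF cocone_hom[OF coc k(1) W], of ?g ?h] g h by (simp del: Hom_simps(3))
    moreover have "?g \<oplus>\<^bsub>Hom K (F k) W\<^esub> ?h \<in> hom_sp K (F k) W"
      using H.add.m_closed[of ?g ?h] g h by (simp del: Hom_simps(3))
    ultimately show "a \<oplus>\<^bsub>Ob X W\<^esub> b \<in> S W" using k(1) unfolding S_def by blast
  next
    fix c a assume c: "c \<in> carrier K" and "a \<in> S W"
    then obtain i g where a: "i \<in> I" "g \<in> hom_sp K (F i) W" "a = \<kappa> i W g" by (auto simp: S_def)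
    interpret H: module K "Hom K (F i) W" by (rule mH) fact+
    have "c \<odot>\<^bsub>Ob X W\<^esub> a = \<kappa> i W (c \<odot>\<^bsub>Hom K (F i) W\<^esub> g)"
      using hom_sp_smult[OF cocone_hom[OF coc a(1) W] c, of g] a by (simp del: Hom_simps(4))
    moreover have "c \<odot>\<^bsub>Hom K (F i) W\<^esub> g \<in> hom_sp K (F i) W"
      using H.smult_closed[OF c, of g] a by (simp del: Hom_simps(4))
    ultimately show "c \<odot>\<^bsub>Ob X W\<^esub> a \<in> S W" using a(1) unfolding S_def by blast
  qed
  have ArS: "Ar X W W' f a \<in> S W'" if "W \<in> Vect K elts" "W' \<in> Vect K elts" "f \<in> hom_sp K W W'" "a \<in> S W"
    for W W' f a
  proof -
    from that(4) obtain i g where a: "i \<in> I" "g \<in> hom_sp K (F i) W" "a = \<kappa> i W g" by (auto simp: S_def)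
    have "Ar X W W' f a = \<kappa> i W' (compose (carrier (F i)) f g)"
      using cocone_natural[OF coc a(1) that(1-3) a(2)] a(3) by simp
    moreover have "compose (carrier (F i)) f g \<in> hom_sp K (F i) W'"
      by (rule hom_sp_compose[OF Vect_module[OF FV[OF a(1)]] a(2) that(3)])
    ultimately show ?thesis using a(1) unfolding S_def by blast
  qed
  \<comment> \<open>Only the carriers shrink, while zero, addition and scalars stay those of
    \<open>X\<close>; thus the inclusion into \<open>X\<close> is the identity on elements.\<close>
  define Z where "Z = \<lparr>Ob = (\<lambda>W. Ob X W\<lparr>carrier := S W\<rparr>), Ar = (\<lambda>W W' f. restrict (Ar X W W' f) (S W))\<rparr>"
  have Z_simps: "Ob Z W = Ob X W\<lparr>carrier := S W\<rparr>" "Ar Z W W' f = restrict (Ar X W W' f) (S W)" for W W' f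
    by (simp_all add: Z_def)
  have Z: "Z \<in> Functors K elts"
    unfolding Functors_def mem_Collect_eq
  proof (intro conjI ballI)
    fix W assume W: "W \<in> Vect K elts"
    show "Ob Z W \<in> Vect K elts"
      using submodule.submodule_is_module[OF sS[OF W] mX[OF W]]
        small_subset[OF Vect_small[OF Functors_Ob[OF X W]] sub[OF W]]
      by (simp add: Vect_def Z_simps)
    show "Ar Z W W (\<lambda>x\<in>carrier W. x) = (\<lambda>x\<in>carrier (Ob Z W). x)"
      using Functors_id[OF X W] sub[OF W] by (auto simp: Z_simps intro!: restrict_ext)
  next
    fix W W' assume W: "W \<in> Vect K elts" and W': "W' \<in> Vect K elts"
    interpret H: module K "Hom K W W'" by (rule module_Hom[OF Vect_module[OF W] Vect_module[OF W']])
    interpret XW: module K "Ob X W" by (rule mX) fact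
    note SW = XW.submoduleE[OF sS[OF W]]
    have in_S: "a \<in> carrier (Ob X W)" if "a \<in> S W" for a using SW(1) that by blast
    show "restrict (Ar Z W W') (hom_sp K W W') \<in> hom_sp K (Hom K W W') (Hom K (Ob Z W) (Ob Z W'))"
    proof (rule hom_spI)
      fix f assume "f \<in> carrier (Hom K W W')"
      then have f: "f \<in> hom_sp K W W'" by simp
      have "Ar Z W W' f \<in> hom_sp K (Ob Z W) (Ob Z W')"
        by (rule hom_spI)
          (use ArS[OF W W' f] SW in_S hom_sp_add[OF Functors_Ar[OF X W W' f]]
            hom_sp_smult[OF Functors_Ar[OF X W W' f]] in \<open>simp_all add: Z_simps\<close>)
      then show "restrict (Ar Z W W') (hom_sp K W W') f \<in> carrier (Hom K (Ob Z W) (Ob Z W'))"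
        using f by simp
      {
        fix g assume "g \<in> carrier (Hom K W W')"
        then have g: "g \<in> hom_sp K W W'" by simp
        have fg: "f \<oplus>\<^bsub>Hom K W W'\<^esub> g \<in> hom_sp K W W'" using H.add.m_closed[of f g] f g by simp
        have "Ar Z W W' (f \<oplus>\<^bsub>Hom K W W'\<^esub> g) = Ar Z W W' f \<oplus>\<^bsub>Hom K (Ob Z W) (Ob Z W')\<^esub> Ar Z W W' g"
          using Functors_add[OF X W W' f g in_S]
          by (auto simp: Z_simps simp del: Hom_simps(3)) (auto intro!: restrict_ext)
        then show "restrict (Ar Z W W') (hom_sp K W W') (f \<oplus>\<^bsub>Hom K W W'\<^esub> g) =
            restrict (Ar Z W W') (hom_sp K W W') f \<oplus>\<^bsub>Hom K (Ob Z W) (Ob Z W')\<^esub>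
            restrict (Ar Z W W') (hom_sp K W W') g"
          using f g fg by (simp del: Hom_simps)
      next
        fix c assume c: "c \<in> carrier K"
        have cf: "c \<odot>\<^bsub>Hom K W W'\<^esub> f \<in> hom_sp K W W'" using H.smult_closed[of c f] f c by simp
        have "Ar Z W W' (c \<odot>\<^bsub>Hom K W W'\<^esub> f) = c \<odot>\<^bsub>Hom K (Ob Z W) (Ob Z W')\<^esub> Ar Z W W' f"
          using Functors_smult[OF X W W' f c in_S]
          by (auto simp: Z_simps simp del: Hom_simps(4)) (auto intro!: restrict_ext)
        then show "restrict (Ar Z W W') (hom_sp K W W') (c \<odot>\<^bsub>Hom K W W'\<^esub> f) =
            c \<odot>\<^bsub>Hom K (Ob Z W) (Ob Z W')\<^esub> restrict (Ar Z W W') (hom_sp K W W') f"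
          using f cf by (simp del: Hom_simps)
      }
    qed simp
  next
    fix W1 W2 W3 f g
    assume W: "W1 \<in> Vect K elts" "W2 \<in> Vect K elts" "W3 \<in> Vect K elts"
      and f: "f \<in> hom_sp K W1 W2" and g: "g \<in> hom_sp K W2 W3"
    show "Ar Z W1 W3 (compose (carrier W1) g f) =
      compose (carrier (Ob Z W1)) (Ar Z W2 W3 g) (Ar Z W1 W2 f)"
      using Functors_comp[OF X W(2,3) g W(1) f] ArS[OF W(1,2) f] subsetD[OF sub[OF W(1)]]
      by (auto simp: Z_simps compose_def intro!: restrict_ext)
  qed
  have "is_cocone K elts I r F \<phi> Z \<kappa>"
    unfolding is_cocone_def
  proof (intro conjI ballI Z)
    fix i assume i: "i \<in> I"
    note Fi = Vect_module[OF FV[OF i]]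
    show "\<kappa> i \<in> Nat K elts (Yo K (F i)) Z"
      unfolding Nat_def mem_Collect_eq
    proof (intro conjI PiE_I ballI)
      fix W assume W: "W \<in> Vect K elts"
      note h = cocone_hom[OF coc i W]
      show "\<kappa> i W \<in> hom_sp K (Ob (Yo K (F i)) W) (Ob Z W)"
      proof (rule hom_spI)
        show "\<kappa> i W \<in> extensional (carrier (Ob (Yo K (F i)) W))" using hom_sp_ext[OF h] by simp
        fix g assume g: "g \<in> carrier (Ob (Yo K (F i)) W)"
        then show "\<kappa> i W g \<in> carrier (Ob Z W)" using i by (auto simp: Z_simps S_def)
        show "\<kappa> i W (g \<oplus>\<^bsub>Ob (Yo K (F i)) W\<^esub> g') = \<kappa> i W g \<oplus>\<^bsub>Ob Z W\<^esub> \<kappa> i W g'"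
          if "g' \<in> carrier (Ob (Yo K (F i)) W)" for g'
          using hom_sp_add[OF h, of g g'] g that by (simp add: Z_simps del: Hom_simps(3))
        show "\<kappa> i W (c \<odot>\<^bsub>Ob (Yo K (F i)) W\<^esub> g) = c \<odot>\<^bsub>Ob Z W\<^esub> \<kappa> i W g" if "c \<in> carrier K" for c
          using hom_sp_smult[OF h that, of g] g by (simp add: Z_simps del: Hom_simps(4))
      qed
      fix W' f g assume W': "W' \<in> Vect K elts" and f: "f \<in> hom_sp K W W'"
        and "g \<in> carrier (Ob (Yo K (F i)) W)"
      then have g: "g \<in> hom_sp K (F i) W" by simp
      then have "\<kappa> i W g \<in> S W" using i by (auto simp: S_def)
      then show "\<kappa> i W' (Ar (Yo K (F i)) W W' f g) = Ar Z W W' f (\<kappa> i W g)"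
        using cocone_natural[OF coc i W W' f g] g by (simp add: Z_simps)
    next
      fix W assume "W \<notin> Vect K elts"
      then show "\<kappa> i W = undefined"
        using cocone_Nat[OF coc i] unfolding Nat_def mem_Collect_eq by (blast intro: PiE_arb)
    qed
  next
    fix ij assume "ij \<in> r"
    then show "case ij of (i, j) \<Rightarrow> \<forall>V\<in>Vect K elts. \<forall>g\<in>hom_sp K (F i) V.
        \<kappa> j V (compose (carrier (F j)) g (\<phi> i j)) = \<kappa> i V g"
      using cocone_comp[OF coc] by (cases ij) simp
  qed
  from colimit_ex1[OF col this]
  obtain \<eta> where \<eta>: "\<eta> \<in> Nat K elts X Z"
    "\<forall>i\<in>I. \<forall>V\<in>Vect K elts. \<forall>g\<in>hom_sp K (F i) V. \<eta> V (\<kappa> i V g) = \<kappa> i V g" by blast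
  have \<eta>_hom: "\<eta> W \<in> hom_sp K (Ob X W) (Ob Z W)" if "W \<in> Vect K elts" for W
    by (rule Nat_hom[OF \<eta>(1) that])
  have \<eta>_S: "\<eta> W a \<in> S W" if "W \<in> Vect K elts" "a \<in> carrier (Ob X W)" for W a
    using hom_sp_closed[OF \<eta>_hom[OF that(1)] that(2)] by (simp add: Z_simps)
  \<comment> \<open>Since \<open>Z\<close> has the operations of \<open>X\<close>, the composite of
    \<open>\<eta>\<close> with the inclusion of \<open>Z\<close> is \<open>\<eta>\<close> itself,
    read as a transformation from \<open>X\<close> to \<open>X\<close>.\<close>
  have "\<eta> \<in> Nat K elts X X"
    unfolding Nat_def mem_Collect_eq
  proof (intro conjI PiE_I ballI)
    fix W assume W: "W \<in> Vect K elts"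
    show "\<eta> W \<in> hom_sp K (Ob X W) (Ob X W)"
    proof (rule hom_spI)
      fix a assume a: "a \<in> carrier (Ob X W)"
      show "\<eta> W a \<in> carrier (Ob X W)" using \<eta>_S[OF W a] sub[OF W] by blast
      show "\<eta> W (a \<oplus>\<^bsub>Ob X W\<^esub> b) = \<eta> W a \<oplus>\<^bsub>Ob X W\<^esub> \<eta> W b" if "b \<in> carrier (Ob X W)" for b
        using hom_sp_add[OF \<eta>_hom[OF W] a that] by (simp add: Z_simps)
      show "\<eta> W (c \<odot>\<^bsub>Ob X W\<^esub> a) = c \<odot>\<^bsub>Ob X W\<^esub> \<eta> W a" if "c \<in> carrier K" for c
        using hom_sp_smult[OF \<eta>_hom[OF W] that a] by (simp add: Z_simps)
    qed (rule hom_sp_ext[OF \<eta>_hom[OF W]])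
    fix W' f a assume "W' \<in> Vect K elts" "f \<in> hom_sp K W W'" and a: "a \<in> carrier (Ob X W)"
    then show "\<eta> W' (Ar X W W' f a) = Ar X W W' f (\<eta> W a)"
      using Nat_natural[OF \<eta>(1) W] \<eta>_S[OF W a] by (simp add: Z_simps)
  next
    fix W assume "W \<notin> Vect K elts"
    then show "\<eta> W = undefined"
      using \<eta>(1) unfolding Nat_def mem_Collect_eq by (blast intro: PiE_arb)
  qed
  moreover define \<iota> where "\<iota> = (\<lambda>W\<in>Vect K elts. \<lambda>a\<in>carrier (Ob X W). a)"
  have "\<iota> \<in> Nat K elts X X"
    unfolding Nat_def mem_Collect_eq
  proof (intro conjI PiE_I ballI)
    fix W assume W: "W \<in> Vect K elts"
    show "\<iota> W \<in> hom_sp K (Ob X W) (Ob X W)"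
      using hom_sp_id[OF mX[OF W]] W by (simp add: \<iota>_def)
    fix W' f a assume "W' \<in> Vect K elts" "f \<in> hom_sp K W W'" "a \<in> carrier (Ob X W)"
    then show "\<iota> W' (Ar X W W' f a) = Ar X W W' f (\<iota> W a)"
      using hom_sp_closed[OF Functors_Ar[OF X W]] W by (simp add: \<iota>_def)
  qed (simp add: \<iota>_def)
  moreover have "\<forall>i\<in>I. \<forall>V\<in>Vect K elts. \<forall>g\<in>hom_sp K (F i) V. \<iota> V (\<kappa> i V g) = \<kappa> i V g"
    using cocone_closed[OF coc] by (simp add: \<iota>_def)
  ultimately have "\<eta> = \<iota>" using colimit_ex1[OF col coc] \<eta>(2) by blast
  then have "x \<in> S V" using \<eta>_S[OF V x] V x by (simp add: \<iota>_def)
  then show ?thesis using that unfolding S_def by blast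
qed

section \<open>The Mittag-Leffler condition\<close>

lemma Q4_freeD:
  fixes X :: "('k, 'u, 'u) vfunctor"
  assumes "X \<in> Functors K elts" "Q4_free K elts X" "V \<in> Vect K elts"
    and "subspace_filter K V F" "\<Inter>F = {\<zero>\<^bsub>V\<^esub>}" "x \<in> carrier (Ob X V)"
    and "\<And>W H f. \<lbrakk>W \<in> Vect K elts; H \<in> F; f \<in> Yo_vanishing K V H W\<rbrakk> \<Longrightarrow> Ar X V W f x = \<zero>\<^bsub>Ob X W\<^esub>"
  shows "x = \<zero>\<^bsub>Ob X V\<^esub>"
  by (rule iffD1[OF Q4_free_iff[OF assms(1)] assms(2), THEN bspec[OF _ assms(3)],
      THEN spec[of _ F], THEN mp[OF _ assms(4)], THEN mp[OF _ assms(5)],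
      THEN bspec[OF _ assms(6)], THEN mp]) (intro ballI assms(7))

lemma Q4_freeI:
  fixes X :: "('k, 'u, 'u) vfunctor"
  assumes "X \<in> Functors K elts"
    and "\<And>V F x. \<lbrakk>V \<in> Vect K elts; subspace_filter K V F; \<Inter>F = {\<zero>\<^bsub>V\<^esub>}; x \<in> carrier (Ob X V);
      \<And>W H f. \<lbrakk>W \<in> Vect K elts; H \<in> F; f \<in> Yo_vanishing K V H W\<rbrakk> \<Longrightarrow> Ar X V W f x = \<zero>\<^bsub>Ob X W\<^esub>\<rbrakk>
      \<Longrightarrow> x = \<zero>\<^bsub>Ob X V\<^esub>"
  shows "Q4_free K elts X"
  unfolding Q4_free_iff[OF assms(1)]
proof (intro ballI allI impI, goal_cases)
  case (1 V F x)
  show ?case by (rule assms(2)[OF 1(1-4)]) (rule 1(5)[THEN bspec, THEN bspec, THEN bspec])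
qed

text \<open>One inclusion suffices: for \<open>j\<close> above \<open>e\<close> the reverse one
  holds in any diagram, because \<open>\<phi> i j\<close> factors through
  \<open>\<phi> i e\<close>.\<close>

definition images_stabilize ::
  "('i \<Rightarrow> ('k, 'u) module) \<Rightarrow> 'i rel \<Rightarrow> ('i \<Rightarrow> 'i \<Rightarrow> 'u \<Rightarrow> 'u) \<Rightarrow> 'i \<Rightarrow> 'i \<Rightarrow> bool" where
  "images_stabilize F r \<phi> i e \<longleftrightarrow>
     (i, e) \<in> r \<and> (\<forall>j. (e, j) \<in> r \<longrightarrow> \<phi> i e ` carrier (F e) \<subseteq> \<phi> i j ` carrier (F j))"

context universe
begin

text \<open>The converse of \<open>colimit_leg_eq_zeroD\<close>, valid for any cocone: rewriting at
  index \<open>j\<close> turns \<open>g\<close> into the zero map.\<close>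

lemma cocone_zero:
  assumes dia: "op_diagram K elts I r F \<phi>" and coc: "is_cocone K elts I r F \<phi> X \<kappa>"
    and dir: "directed_poset I r" and ij: "(i, j) \<in> r" and V: "V \<in> Vect K elts"
    and g: "g \<in> hom_sp K (F i) V" and zero: "\<And>x. x \<in> carrier (F j) \<Longrightarrow> g (\<phi> i j x) = \<zero>\<^bsub>V\<^esub>"
  shows "\<kappa> i V g = \<zero>\<^bsub>Ob X V\<^esub>"
proof -
  have j: "j \<in> I" using directed_field[OF dir ij] by simp
  have "\<kappa> i V g = \<kappa> j V (compose (carrier (F j)) g (\<phi> i j))"
    using cocone_comp[OF coc ij V g] by simp
  also have "compose (carrier (F j)) g (\<phi> i j) = \<zero>\<^bsub>Hom K (F j) V\<^esub>"
    using zero by (auto simp: compose_def intro!: restrict_ext)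
  also have "\<kappa> j V \<dots> = \<zero>\<^bsub>Ob X V\<^esub>"
    by (rule hom_sp_zero[OF module_Hom[OF Vect_module[OF op_diagram_Ob[OF dia j]] Vect_module[OF V]]
      Vect_module[OF Functors_Ob[OF cocone_functor[OF coc] V]] cocone_hom[OF coc j V]])
  finally show ?thesis .
qed

text \<open>Let \<open>J\<close> be the intersection of the images in \<open>F d\<close> and
  \<open>p\<close> the projection to \<open>V = F d / J\<close>. A map \<open>f\<close> on
  \<open>V\<close> that vanishes on the projected image of some \<open>F e\<close> kills the class
  of \<open>p\<close>, since \<open>f\<close> after \<open>p\<close> becomes zero at index
  \<open>e\<close>. Freeness then says that the class of \<open>p\<close> is zero. Hence
  \<open>p\<close> dies on the image of some \<open>F e\<close>, that is, this image lies in
  \<open>J\<close> and so in all the others.\<close>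

lemma images_stabilize_of_Q4_free:
  fixes K :: "('k, 'm) ring_scheme" and X :: "('k, 'u, 'u) vfunctor" and I :: "'i set"
  assumes dir: "directed_poset I r" and dia: "op_diagram K elts I r F \<phi>"
    and col: "is_colimit K elts I r F \<phi> X \<kappa>" and enc: "encodable elts I"
    and free: "Q4_free K elts X" and d: "d \<in> I"
  obtains e where "images_stabilize F r \<phi> d e"
proof -
  note coc = colimit_cocone[OF col]
  note X = cocone_functor[OF coc]
  note rI = directed_field[OF dir]
  define im where "im e = \<phi> d e ` carrier (F e)" for e
  define J where "J = (\<Inter>e\<in>{e. (d, e) \<in> r}. im e)"
  have Fd: "F d \<in> Vect K elts" by (rule op_diagram_Ob[OF dia d])
  interpret Fd: module K "F d" by (rule Vect_module[OF Fd])
  have dd: "(d, d) \<in> r" by (rule directed_refl[OF dir d])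
  have s_im: "submodule (im e) K (F d)" if de: "(d, e) \<in> r" for e
  proof -
    have "module K (F e)" using rI[OF de] by (intro Vect_module[OF op_diagram_Ob[OF dia]]) simp
    then show ?thesis
      unfolding im_def
      by (intro hom_sp_image_submodule[OF _ Fd.module_axioms op_diagram_hom[OF dia de]]
          module.carrier_is_submodule)
  qed
  have im_mono: "im f \<subseteq> im e" if "(d, e) \<in> r" "(e, f) \<in> r" for e f
    using op_diagram_comp[OF dia that] hom_sp_closed[OF op_diagram_hom[OF dia that(2)]]
    by (auto simp: im_def)
  have J_im: "J \<subseteq> im e" if "(d, e) \<in> r" for e using that by (auto simp: J_def)
  have sJ: "submodule J K (F d)"
  proof (rule Fd.submoduleI')
    show "J \<subseteq> carrier (F d)" using J_im[OF dd] Fd.submoduleE(1)[OF s_im[OF dd]] by blast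
    show "\<zero>\<^bsub>F d\<^esub> \<in> J" using Fd.submodule_zero[OF s_im] by (simp add: J_def)
    show "a \<oplus>\<^bsub>F d\<^esub> b \<in> J" if "a \<in> J" "b \<in> J" for a b
      using that Fd.submoduleE(5)[OF s_im] by (simp add: J_def)
    show "c \<odot>\<^bsub>F d\<^esub> a \<in> J" if "c \<in> carrier K" "a \<in> J" for c a
      using that Fd.submoduleE(4)[OF s_im] by (simp add: J_def)
  qed
  obtain V p where V: "V \<in> Vect K elts" and p: "p \<in> hom_sp K (F d) V"
    and surj: "p ` carrier (F d) = carrier V"
    and ker: "\<And>x. x \<in> carrier (F d) \<Longrightarrow> p x = \<zero>\<^bsub>V\<^esub> \<longleftrightarrow> x \<in> J"
    using small_quotient[OF Fd.module_axioms sJ encodable_small[OF Vect_small[OF Fd]]] by metis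
  interpret V: module K V by (rule Vect_module[OF V])
  have s_pim: "submodule (p ` im e) K V" if "(d, e) \<in> r" for e
    by (rule hom_sp_image_submodule[OF Fd.module_axioms V.module_axioms p s_im[OF that]])
  \<comment> \<open>The images decrease along a directed order, so their projections form a filter
    base.\<close>
  define \<F> where "\<F> = {H. submodule H K V \<and> (\<exists>e. (d, e) \<in> r \<and> p ` im e \<subseteq> H)}"
  have pim: "p ` im e \<in> \<F>" if "(d, e) \<in> r" for e
    using that s_pim[OF that] by (auto simp: \<F>_def)
  have filter: "subspace_filter K V \<F>"
    unfolding subspace_filter_def
  proof (intro conjI ballI allI impI)
    show "\<F> \<noteq> {}" using pim[OF dd] by blast
  next
    fix H assume "H \<in> \<F>"
    then show "submodule H K V" by (simp add: \<F>_def)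
  next
    fix H H' assume "H \<in> \<F>" "H' \<in> \<F>"
    then obtain e e' where H: "submodule H K V" "(d, e) \<in> r" "p ` im e \<subseteq> H"
      and H': "submodule H' K V" "(d, e') \<in> r" "p ` im e' \<subseteq> H'" unfolding \<F>_def by blast
    obtain f where f: "(e, f) \<in> r" "(e', f) \<in> r"
      using directed_bound[OF dir, of e e'] rI[OF H(2)] rI[OF H'(2)] by blast
    have "submodule (H \<inter> H') K V"
      using V.submoduleE[OF H(1)] V.submoduleE[OF H'(1)] V.submodule_zero[OF H(1)] V.submodule_zero[OF H'(1)]
      by (intro V.submoduleI') auto
    moreover have "p ` im f \<subseteq> H \<inter> H'"
      using im_mono[OF H(2) f(1)] im_mono[OF H'(2) f(2)] H(3) H'(3) by blast
    moreover have "(d, f) \<in> r" by (rule directed_trans[OF dir H(2) f(1)])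
    ultimately show "H \<inter> H' \<in> \<F>" unfolding \<F>_def by blast
  next
    fix H H' assume "H \<in> \<F>" "submodule H' K V" "H \<subseteq> H'"
    then show "H' \<in> \<F>" unfolding \<F>_def by blast
  qed
  have inter: "\<Inter>\<F> = {\<zero>\<^bsub>V\<^esub>}"
  proof (intro equalityI subsetI)
    fix y assume y: "y \<in> \<Inter>\<F>"
    then have "y \<in> carrier V" using pim[OF dd] V.submoduleE(1)[OF s_pim[OF dd]] by blast
    then obtain v where v: "v \<in> carrier (F d)" "y = p v" using surj by blast
    \<comment> \<open>The kernel \<open>J\<close> of \<open>p\<close> is contained in
      \<open>im e\<close>, so a vector whose projection lies in that of \<open>im e\<close> lies in
      \<open>im e\<close> itself.\<close>
    have "v \<in> im e" if e: "(d, e) \<in> r" for e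
    proof -
      obtain w where w: "w \<in> im e" "p v = p w" using y pim[OF e] v(2) by blast
      have wd: "w \<in> carrier (F d)" using w(1) Fd.submoduleE(1)[OF s_im[OF e]] by blast
      have "p (v \<ominus>\<^bsub>F d\<^esub> w) = \<zero>\<^bsub>V\<^esub>"
        using hom_sp_minus[OF Fd.module_axioms V.module_axioms p v(1) wd] w(2)
          hom_sp_closed[OF p wd] by (simp add: V.minus_eq_zero_iff)
      then have "v \<ominus>\<^bsub>F d\<^esub> w \<in> im e" using ker[of "v \<ominus>\<^bsub>F d\<^esub> w"] v(1) wd J_im[OF e] by auto
      then have "(v \<ominus>\<^bsub>F d\<^esub> w) \<oplus>\<^bsub>F d\<^esub> w \<in> im e" using Fd.submoduleE(5)[OF s_im[OF e]] w(1) by blast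
      then show ?thesis using v(1) wd by (simp add: a_minus_def Fd.a_assoc Fd.l_neg)
    qed
    then have "v \<in> J" by (simp add: J_def)
    then show "y \<in> {\<zero>\<^bsub>V\<^esub>}" using ker[OF v(1)] v(2) by simp
  next
    fix y assume "y \<in> {\<zero>\<^bsub>V\<^esub>}"
    moreover have "\<zero>\<^bsub>V\<^esub> \<in> H" if "H \<in> \<F>" for H
      by (rule V.submodule_zero[OF filter_submodule[OF filter that]])
    ultimately show "y \<in> \<Inter>\<F>" by blast
  qed
  have "\<kappa> d V p = \<zero>\<^bsub>Ob X V\<^esub>"
  proof (rule Q4_freeD[OF X free V filter inter cocone_closed[OF coc d V p]])
    fix W H f assume W: "W \<in> Vect K elts" and H: "H \<in> \<F>" and f: "f \<in> Yo_vanishing K V H W"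
    have f_hom: "f \<in> hom_sp K V W" and f0: "\<And>x. x \<in> H \<Longrightarrow> f x = \<zero>\<^bsub>W\<^esub>"
      using f by (auto simp: Yo_vanishing_def)
    obtain e where e: "(d, e) \<in> r" "p ` im e \<subseteq> H" using H unfolding \<F>_def by blast
    have "compose (carrier (F d)) f p (\<phi> d e x) = \<zero>\<^bsub>W\<^esub>" if "x \<in> carrier (F e)" for x
    proof -
      have "p (\<phi> d e x) \<in> H" using e(2) that by (auto simp: im_def)
      then show ?thesis
        using f0 hom_sp_closed[OF op_diagram_hom[OF dia e(1)] that] by (simp add: compose_eq)
    qed
    then have "\<kappa> d W (compose (carrier (F d)) f p) = \<zero>\<^bsub>Ob X W\<^esub>"
      by (rule cocone_zero[OF dia coc dir e(1) W hom_sp_compose[OF Fd.module_axioms p f_hom]])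
    then show "Ar X V W f (\<kappa> d V p) = \<zero>\<^bsub>Ob X W\<^esub>"
      using cocone_natural[OF coc d V W f_hom p] by simp
  qed
  then obtain e where e: "(d, e) \<in> r" "\<And>x. x \<in> carrier (F e) \<Longrightarrow> p (\<phi> d e x) = \<zero>\<^bsub>V\<^esub>"
    using colimit_leg_eq_zeroD[OF dir dia col enc d V p] by blast
  have "im e \<subseteq> J"
    using ker e(2) hom_sp_closed[OF op_diagram_hom[OF dia e(1)]] by (auto simp: im_def)
  then have "images_stabilize F r \<phi> d e"
    using J_im directed_trans[OF dir e(1)] e(1) unfolding images_stabilize_def im_def by blast
  then show ?thesis by (rule that)
qed

text \<open>An element \<open>x\<close> comes from some \<open>h\<close> at an index
  \<open>i\<close>. Testing it against the projection of \<open>V\<close> to \<open>V/H\<close>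
  shows that \<open>h\<close> sends the image of some \<open>F j\<close> into \<open>H\<close>. The
  stable image is contained in that image, so \<open>h\<close> maps one and the same subspace into
  every \<open>H\<close> of the filter, hence to zero.\<close>

lemma Q4_free_of_images_stabilize:
  fixes K :: "('k, 'm) ring_scheme" and X :: "('k, 'u, 'u) vfunctor" and I :: "'i set"
  assumes dir: "directed_poset I r" and dia: "op_diagram K elts I r F \<phi>"
    and col: "is_colimit K elts I r F \<phi> X \<kappa>" and enc: "encodable elts I"
    and stab: "\<And>i. i \<in> I \<Longrightarrow> \<exists>e. images_stabilize F r \<phi> i e"
  shows "Q4_free K elts X"
proof (rule Q4_freeI)
  note coc = colimit_cocone[OF col]
  note rI = directed_field[OF dir]
  show X: "X \<in> Functors K elts" by (rule cocone_functor[OF coc])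
  fix V \<F> x assume V: "V \<in> Vect K elts" and filter: "subspace_filter K V \<F>"
    and inter: "\<Inter>\<F> = {\<zero>\<^bsub>V\<^esub>}" and x: "x \<in> carrier (Ob X V)"
    and van: "\<And>W H f. \<lbrakk>W \<in> Vect K elts; H \<in> \<F>; f \<in> Yo_vanishing K V H W\<rbrakk> \<Longrightarrow> Ar X V W f x = \<zero>\<^bsub>Ob X W\<^esub>"
  obtain i h where i: "i \<in> I" and h: "h \<in> hom_sp K (F i) V" and xh: "x = \<kappa> i V h"
    by (rule colimit_legs_surj[OF dir dia col V x])
  obtain e where ie: "(i, e) \<in> r" and e: "\<And>j. (e, j) \<in> r \<Longrightarrow> \<phi> i e ` carrier (F e) \<subseteq> \<phi> i j ` carrier (F j)"
    using stab[OF i] unfolding images_stabilize_def by blast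
  have mV: "module K V" by (rule Vect_module[OF V])
  have Fi: "module K (F i)" by (rule Vect_module[OF op_diagram_Ob[OF dia i]])
  have "h (\<phi> i e y) \<in> H" if H: "H \<in> \<F>" and y: "y \<in> carrier (F e)" for H y
  proof -
    note sH = filter_submodule[OF filter H]
    obtain Q q where Q: "Q \<in> Vect K elts" and q: "q \<in> hom_sp K V Q"
      and ker: "\<And>x. x \<in> carrier V \<Longrightarrow> q x = \<zero>\<^bsub>Q\<^esub> \<longleftrightarrow> x \<in> H"
      using small_quotient[OF mV sH encodable_small[OF Vect_small[OF V]]] by metis
    have "q \<in> Yo_vanishing K V H Q"
      using q ker module.submoduleE(1)[OF mV sH] by (auto simp: Yo_vanishing_def)
    then have "\<kappa> i Q (compose (carrier (F i)) q h) = \<zero>\<^bsub>Ob X Q\<^esub>"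
      using van[OF Q H] cocone_natural[OF coc i V Q q h] xh by simp
    then obtain j where j: "(i, j) \<in> r"
      "\<And>z. z \<in> carrier (F j) \<Longrightarrow> compose (carrier (F i)) q h (\<phi> i j z) = \<zero>\<^bsub>Q\<^esub>"
      using colimit_leg_eq_zeroD[OF dir dia col enc i Q hom_sp_compose[OF Fi h q]] by blast
    \<comment> \<open>The index \<open>j\<close> depends on \<open>H\<close> and need not be above
      \<open>e\<close>; stability is therefore applied at a common bound \<open>k\<close>, whose
      image lies in that of \<open>F j\<close>.\<close>
    obtain k where k: "(e, k) \<in> r" "(j, k) \<in> r"
      using directed_bound[OF dir, of e j] rI[OF ie] rI[OF j(1)] by blast
    obtain z where z: "z \<in> carrier (F k)" "\<phi> i e y = \<phi> i k z" using e[OF k(1)] y by blast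
    have z': "\<phi> j k z \<in> carrier (F j)" by (rule hom_sp_closed[OF op_diagram_hom[OF dia k(2)] z(1)])
    have "\<phi> i e y = \<phi> i j (\<phi> j k z)" using op_diagram_comp[OF dia j(1) k(2) z(1)] z(2) by simp
    moreover have "\<phi> i e y \<in> carrier (F i)" by (rule hom_sp_closed[OF op_diagram_hom[OF dia ie] y])
    ultimately have "q (h (\<phi> i e y)) = \<zero>\<^bsub>Q\<^esub>" "h (\<phi> i e y) \<in> carrier V"
      using j(2)[OF z'] hom_sp_closed[OF h] by (simp_all add: compose_eq)
    then show ?thesis using ker by blast
  qed
  then have "h (\<phi> i e y) = \<zero>\<^bsub>V\<^esub>" if "y \<in> carrier (F e)" for y
    using that inter by blast
  then show "x = \<zero>\<^bsub>Ob X V\<^esub>"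
    unfolding xh by (rule cocone_zero[OF dia coc dir ie V h])
qed

end

section \<open>Tensor products\<close>

lemma is_tensorD:
  assumes "is_tensor K elts V W P \<beta>"
  shows tensor_Vect: "P \<in> Vect K elts"
    and tensor_pure: "\<lbrakk>x \<in> carrier V; y \<in> carrier W\<rbrakk> \<Longrightarrow> \<beta> x y \<in> carrier P"
proof -
  show "P \<in> Vect K elts" using assms by (simp add: is_tensor_def)
  show "\<beta> x y \<in> carrier P" if "x \<in> carrier V" "y \<in> carrier W"
  proof -
    have "(\<lambda>y\<in>carrier W. \<beta> x y) \<in> hom_sp K W P"
      using assms that(1) by (simp add: is_tensor_def bilinear_on_def)
    from hom_sp_closed[OF this that(2)] show ?thesis using that(2) by simp
  qed
qed

text \<open>The projection of \<open>P\<close> modulo \<open>S\<close> and the zero map agree on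
  pure tensors, so the uniqueness part of the universal property identifies them. The quotient is
  taken in its encoded form because that property only concerns targets in
  \<open>Vect\<close>.\<close>

lemma (in universe) tensor_generated:
  fixes K :: "('k, 'm) ring_scheme"
  assumes T: "is_tensor K elts V W P \<beta>" and V: "V \<in> Vect K elts" and W: "W \<in> Vect K elts"
    and S: "submodule S K P"
    and pure: "\<And>x y. \<lbrakk>x \<in> carrier V; y \<in> carrier W\<rbrakk> \<Longrightarrow> \<beta> x y \<in> S"
  shows "carrier P \<subseteq> S"
proof -
  have P: "P \<in> Vect K elts" using T by (simp add: is_tensor_def)
  interpret P: module K P by (rule Vect_module[OF P])
  interpret V: module K V by (rule Vect_module[OF V])
  interpret W: module K W by (rule Vect_module[OF W])
  obtain Q q where Q: "Q \<in> Vect K elts" and q: "q \<in> hom_sp K P Q"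
    and ker: "\<And>x. x \<in> carrier P \<Longrightarrow> q x = \<zero>\<^bsub>Q\<^esub> \<longleftrightarrow> x \<in> S"
    using small_quotient[OF P.module_axioms S encodable_small[OF Vect_small[OF P]]] by metis
  interpret Q: module K Q by (rule Vect_module[OF Q])
  have zero: "(\<lambda>x\<in>carrier U. \<zero>\<^bsub>Q\<^esub>) \<in> hom_sp K U Q" if "module K U" for U :: "('k, 'u) module"
    using module.smult_closed[OF that] abelian_group.axioms(1)[OF module.axioms(2)[OF that]]
    by (intro hom_spI) (auto simp: abelian_monoid.a_closed)
  have "bilinear_on K V W Q (\<lambda>x y. \<zero>\<^bsub>Q\<^esub>)"
    by (simp add: bilinear_on_def zero V.module_axioms W.module_axioms)
  then have "\<exists>!f. f \<in> hom_sp K P Q \<and> (\<forall>x\<in>carrier V. \<forall>y\<in>carrier W. f (\<beta> x y) = \<zero>\<^bsub>Q\<^esub>)"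
    using T Q unfolding is_tensor_def by blast
  moreover have "\<forall>x\<in>carrier V. \<forall>y\<in>carrier W. q (\<beta> x y) = \<zero>\<^bsub>Q\<^esub>"
    using ker pure P.submoduleE(1)[OF S] by blast
  moreover have "\<forall>x\<in>carrier V. \<forall>y\<in>carrier W. (\<lambda>x\<in>carrier P. \<zero>\<^bsub>Q\<^esub>) (\<beta> x y) = \<zero>\<^bsub>Q\<^esub>"
    using pure P.submoduleE(1)[OF S] by auto
  ultimately have "q = (\<lambda>x\<in>carrier P. \<zero>\<^bsub>Q\<^esub>)" using q zero[OF P.module_axioms] by blast
  then show ?thesis using ker by auto
qed

text \<open>The set where \<open>f\<close> and \<open>g\<close> agree is a submodule containing the
  pure tensors. This serves to compare transition maps, which are specified on pure tensors.\<close>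

lemma (in universe) tensor_hom_eqI:
  fixes K :: "('k, 'm) ring_scheme" and Z :: "('k, 'a) module"
  assumes T: "is_tensor K elts V W P \<beta>" and V: "V \<in> Vect K elts" and W: "W \<in> Vect K elts"
    and Z: "module K Z" and f: "f \<in> hom_sp K P Z" and g: "g \<in> hom_sp K P Z"
    and eq: "\<And>x y. \<lbrakk>x \<in> carrier V; y \<in> carrier W\<rbrakk> \<Longrightarrow> f (\<beta> x y) = g (\<beta> x y)"
  shows "f = g"
proof (rule hom_sp_eqI[OF f g])
  interpret P: module K P by (rule Vect_module[OF tensor_Vect[OF T]])
  let ?S = "{p \<in> carrier P. f p = g p}"
  have "submodule ?S K P"
    using hom_sp_zero[OF P.module_axioms Z f] hom_sp_zero[OF P.module_axioms Z g]
    by (intro P.submoduleI')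
      (auto simp: hom_sp_add[OF f] hom_sp_add[OF g] hom_sp_smult[OF f] hom_sp_smult[OF g])
  then have "carrier P \<subseteq> ?S"
    by (rule tensor_generated[OF T V W]) (simp add: tensor_pure[OF T] eq)
  then show "f x = g x" if "x \<in> carrier P" for x using that by blast
qed

theorem proposition6p6:
  fixes K :: "('k, 'm) ring_scheme"
    and elts :: "'u \<Rightarrow> 'u set"
    and X0 X1 T :: "('k, 'u, 'u) vfunctor"
  assumes "field K"
    and "grothendieck_universe elts"
    and "X0 \<in> Ind_Vect_op K elts"
    and "X1 \<in> Ind_Vect_op K elts"
    and "Q4_free K elts X0"
    and "Q4_free K elts X1"
    and "is_ind_tensor K elts X0 X1 T"
  shows "Q4_free K elts T"
proof -
  interpret universe elts by unfold_locales fact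
  obtain D r F \<phi> B s G \<psi> P \<beta> \<tau> \<nu> where
    X0: "ind_presentation K elts D r F \<phi> X0" and X1: "ind_presentation K elts B s G \<psi> X1"
    and tensor': "\<forall>d\<in>D. \<forall>b\<in>B. is_tensor K elts (F d) (G b) (P (d, b)) (\<beta> (d, b))"
    and \<tau>': "\<forall>(d, d')\<in>r. \<forall>(b, b')\<in>s.
           \<tau> (d, b) (d', b') \<in> hom_sp K (P (d', b')) (P (d, b)) \<and>
           (\<forall>x\<in>carrier (F d'). \<forall>y\<in>carrier (G b').
              \<tau> (d, b) (d', b') (\<beta> (d', b') x y) = \<beta> (d, b) (\<phi> d d' x) (\<psi> b b' y))"
    and col: "is_colimit K elts (D \<times> B) (prod_rel r s) P \<tau> T \<nu>"
    using assms(7) unfolding is_ind_tensor_def by (elim exE conjE) (rule that)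
  obtain \<kappa>0 where r: "directed_poset D r" and F: "op_diagram K elts D r F \<phi>"
    and col0: "is_colimit K elts D r F \<phi> X0 \<kappa>0" and D: "small elts D"
    using X0 unfolding ind_presentation_def by (elim exE conjE) (rule that)
  obtain \<kappa>1 where s: "directed_poset B s" and G: "op_diagram K elts B s G \<psi>"
    and col1: "is_colimit K elts B s G \<psi> X1 \<kappa>1" and B: "small elts B"
    using X1 unfolding ind_presentation_def by (elim exE conjE) (rule that)
  have tensor: "is_tensor K elts (F d) (G b) (P (d, b)) (\<beta> (d, b))" if "d \<in> D" "b \<in> B" for d b
    using tensor' that by blast
  have \<tau>: "\<tau> (d, b) (d', b') \<in> hom_sp K (P (d', b')) (P (d, b))"
    and \<tau>_pure: "\<And>x y. \<lbrakk>x \<in> carrier (F d'); y \<in> carrier (G b')\<rbrakk> \<Longrightarrow>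
        \<tau> (d, b) (d', b') (\<beta> (d', b') x y) = \<beta> (d, b) (\<phi> d d' x) (\<psi> b b' y)"
    if "(d, d') \<in> r" "(b, b') \<in> s" for d d' b b'
    using \<tau>' that by blast+
  note rD = directed_field[OF r] and sB = directed_field[OF s]
  note FV = op_diagram_Ob[OF F] and GV = op_diagram_Ob[OF G]
  note \<phi> = hom_sp_closed[OF op_diagram_hom[OF F]] and \<psi> = hom_sp_closed[OF op_diagram_hom[OF G]]
  have P: "P (d, b) \<in> Vect K elts" if "d \<in> D" "b \<in> B" for d b
    by (rule tensor_Vect[OF tensor[OF that]])
  have pure: "\<beta> (d, b) x y \<in> carrier (P (d, b))"
    if "d \<in> D" "b \<in> B" "x \<in> carrier (F d)" "y \<in> carrier (G b)" for d b x y
    by (rule tensor_pure[OF tensor[OF that(1,2)] that(3,4)])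
  \<comment> \<open>The transitions \<open>\<tau>\<close> are given through their values on pure
    tensors; that they form a diagram is recovered from the functoriality of the two
    factors.\<close>
  have dia: "op_diagram K elts (D \<times> B) (prod_rel r s) P \<tau>"
    unfolding op_diagram_def
  proof (intro conjI ballI allI impI)
    fix i assume "i \<in> D \<times> B"
    then obtain d b where i: "i = (d, b)" "d \<in> D" "b \<in> B" by blast
    show "P i \<in> Vect K elts" using P i by blast
    have mP: "module K (P (d, b))" by (rule Vect_module[OF P[OF i(2,3)]])
    note db = directed_refl[OF r i(2)] directed_refl[OF s i(3)]
    show "\<tau> i i = (\<lambda>x\<in>carrier (P i). x)"
      unfolding i(1)
      by (rule tensor_hom_eqI[OF tensor[OF i(2,3)] FV[OF i(2)] GV[OF i(3)] mP \<tau>[OF db] hom_sp_id[OF mP]])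
        (simp add: \<tau>_pure[OF db] op_diagram_id[OF F i(2)] op_diagram_id[OF G i(3)] pure[OF i(2,3)])
  next
    fix ij assume "ij \<in> prod_rel r s"
    then show "case ij of (i, j) \<Rightarrow> \<tau> i j \<in> hom_sp K (P j) (P i)"
      using \<tau> unfolding prod_rel_def by blast
  next
    fix i j k assume "(i, j) \<in> prod_rel r s" "(j, k) \<in> prod_rel r s"
    then obtain d b d' b' d'' b'' where ijk: "i = (d, b)" "j = (d', b')" "k = (d'', b'')"
      and r1: "(d, d') \<in> r" and s1: "(b, b') \<in> s" and r2: "(d', d'') \<in> r" and s2: "(b', b'') \<in> s"
      unfolding prod_rel_def by blast
    have r3: "(d, d'') \<in> r" by (rule directed_trans[OF r r1 r2])
    have s3: "(b, b'') \<in> s" by (rule directed_trans[OF s s1 s2])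
    have D: "d \<in> D" "d'' \<in> D" and B: "b \<in> B" "b'' \<in> B" using rD[OF r3] sB[OF s3] by simp_all
    have mP: "module K (P (d, b))" by (rule Vect_module[OF P[OF D(1) B(1)]])
    have mP'': "module K (P (d'', b''))" by (rule Vect_module[OF P[OF D(2) B(2)]])
    show "\<tau> i k = compose (carrier (P k)) (\<tau> i j) (\<tau> j k)"
      unfolding ijk
    proof (rule tensor_hom_eqI[OF tensor[OF D(2) B(2)] FV[OF D(2)] GV[OF B(2)] mP \<tau>[OF r3 s3]
          hom_sp_compose[OF mP'' \<tau>[OF r2 s2] \<tau>[OF r1 s1]]])
      fix x y assume x: "x \<in> carrier (F d'')" and y: "y \<in> carrier (G b'')"
      show "\<tau> (d, b) (d'', b'') (\<beta> (d'', b'') x y) =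
          compose (carrier (P (d'', b''))) (\<tau> (d, b) (d', b')) (\<tau> (d', b') (d'', b'')) (\<beta> (d'', b'') x y)"
        using \<tau>_pure[OF r3 s3 x y] \<tau>_pure[OF r2 s2 x y] \<tau>_pure[OF r1 s1 \<phi>[OF r2 x] \<psi>[OF s2 y]]
          op_diagram_comp[OF F r1 r2 x] op_diagram_comp[OF G s1 s2 y] pure[OF D(2) B(2) x y]
        by (simp add: compose_eq)
    qed
  qed
  have "\<exists>e. images_stabilize P (prod_rel r s) \<tau> i e" if "i \<in> D \<times> B" for i
  proof -
    obtain d b where i: "i = (d, b)" "d \<in> D" "b \<in> B" using \<open>i \<in> D \<times> B\<close> by blast
    obtain e where e: "images_stabilize F r \<phi> d e"
      by (rule images_stabilize_of_Q4_free[OF r F col0 encodable_small[OF D] assms(5) i(2)])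
    obtain c where c: "images_stabilize G s \<psi> b c"
      by (rule images_stabilize_of_Q4_free[OF s G col1 encodable_small[OF B] assms(6) i(3)])
    have de: "(d, e) \<in> r" and bc: "(b, c) \<in> s" using e c by (simp_all add: images_stabilize_def)
    have eD: "e \<in> D" and cB: "c \<in> B" using rD[OF de] sB[OF bc] by simp_all
    \<comment> \<open>The pair of the two stabilizing indices stabilizes the tensor diagram: the
      image of each pure tensor at \<open>(e, c)\<close> is also the image of a pure tensor at
      \<open>(e', c')\<close>.\<close>
    have "\<tau> (d, b) (e, c) ` carrier (P (e, c)) \<subseteq> \<tau> (d, b) (e', c') ` carrier (P (e', c'))"
      if e': "(e, e') \<in> r" and c': "(c, c') \<in> s" for e' c'
    proof -
      have de': "(d, e') \<in> r" by (rule directed_trans[OF r de e'])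
      have bc': "(b, c') \<in> s" by (rule directed_trans[OF s bc c'])
      have eD': "e' \<in> D" and cB': "c' \<in> B" using rD[OF de'] sB[OF bc'] by simp_all
      let ?I = "\<tau> (d, b) (e', c') ` carrier (P (e', c'))"
      interpret P: module K "P (d, b)" by (rule Vect_module[OF P[OF i(2,3)]])
      interpret P1: module K "P (e, c)" by (rule Vect_module[OF P[OF eD cB]])
      interpret P2: module K "P (e', c')" by (rule Vect_module[OF P[OF eD' cB']])
      have sI: "submodule ?I K (P (d, b))"
        by (rule hom_sp_image_submodule[OF P2.module_axioms P.module_axioms \<tau>[OF de' bc']
          P2.carrier_is_submodule])
      \<comment> \<open>The inclusion of images is tested on generators: the preimage of
        \<open>?I\<close> is a submodule, so it suffices that it contains the pure tensors.\<close>
      let ?S = "{p \<in> carrier (P (e, c)). \<tau> (d, b) (e, c) p \<in> ?I}"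
      have "submodule ?S K (P (e, c))"
        using hom_sp_zero[OF P1.module_axioms P.module_axioms \<tau>[OF de bc]] P.submodule_zero[OF sI]
          hom_sp_add[OF \<tau>[OF de bc]] hom_sp_smult[OF \<tau>[OF de bc]] P.submoduleE(4,5)[OF sI]
        by (intro P1.submoduleI') simp_all
      moreover have "\<beta> (e, c) x y \<in> ?S" if x: "x \<in> carrier (F e)" and y: "y \<in> carrier (G c)" for x y
      proof -
        \<comment> \<open>Stability in each factor replaces both arguments by ones at the later
          index with the same images in \<open>F d\<close> and \<open>G b\<close>.\<close>
        obtain x' where x': "x' \<in> carrier (F e')" "\<phi> d e x = \<phi> d e' x'"
          using e e' x unfolding images_stabilize_def by blast
        obtain y' where y': "y' \<in> carrier (G c')" "\<psi> b c y = \<psi> b c' y'"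
          using c c' y unfolding images_stabilize_def by blast
        have "\<tau> (d, b) (e, c) (\<beta> (e, c) x y) = \<tau> (d, b) (e', c') (\<beta> (e', c') x' y')"
          using \<tau>_pure[OF de bc x y] \<tau>_pure[OF de' bc' x'(1) y'(1)] x'(2) y'(2) by simp
        then show ?thesis using pure[OF eD cB x y] pure[OF eD' cB' x'(1) y'(1)] by blast
      qed
      ultimately have "carrier (P (e, c)) \<subseteq> ?S"
        by (rule tensor_generated[OF tensor[OF eD cB] FV[OF eD] GV[OF cB]])
      then show ?thesis by blast
    qed
    then have "images_stabilize P (prod_rel r s) \<tau> (d, b) (e, c)"
      using de bc by (auto simp: images_stabilize_def prod_rel_def)
    then show ?thesis using i(1) by blast
  qed
  \<comment> \<open>The index set consists of pairs, so it is not a subset of \<open>'u\<close>;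
    this is why the colimit lemmas ask for an encodable index set instead of a small one.\<close>
  then show ?thesis
    by (rule Q4_free_of_images_stabilize[OF directed_prod[OF r s] dia col
      encodable_Times[OF encodable_small[OF D] encodable_small[OF B]]])
qed

end
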